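(* Let $N\ge 1$, $\alpha\in\mathbb{R}$, $\sigma>-1$, $m>0$ and $p>1$. Let $\zeta(t)=t^\sigma$ for $0<t<1$ and $\zeta(t)=t^m$ for $t\ge 1$, and let $\mathbf{w}\in C_0(\mathbb{R}^N)\cap L^1(\mathbb{R}^N)$ satisfy $\int_{\mathbb{R}^N}\mathbf{w}(x)\,dx>0$. Then the Cauchy problem $$u_t-\Delta u=|x|^\alpha|u|^p+\zeta(t)\,\mathbf{w}(x)\ \text{ in }(0,\infty)\times\mathbb{R}^N,\qquad u(0,x)=u_0(x)\ \text{ in }\mathbb{R}^N,$$ has no global solutions (whatever the initial datum $u_0$).
   Context: $C_0(\mathbb{R}^N)$ is the space of continuous real-valued functions on $\mathbb{R}^N$ vanishing at infinity; $C_B(\mathbb{R}^N)=C(\mathbb{R}^N)\cap L^\infty(\mathbb{R}^N)$, and $C_B([0,T]\times\mathbb{R}^N)$ is defined similarly; $e^{t\Delta}$ is the heat semigroup, i.e. convolution with $G_t(x)=(4\pi t)^{-N/2}e^{-|x|^2/(4t)}$. Solutions may change sign. A global solution is a function $u$ on $[0,\infty)\times\mathbb{R}^N$ as follows. (a) If $\alpha\le 0$: $u_0\in C_B(\mathbb{R}^N)$, $u\in C_B([0,T]\times\mathbb{R}^N)$ for every $T>0$, and $u$ is a mild solution, i.e. for all $t\ge0$ (with the integrals convergent) $$u(t)=e^{t\Delta}u_0+\int_0^t e^{(t-\tau)\Delta}\left(|\cdot|^\alpha|u(\tau)|^p\right)d\tau+\int_0^t e^{(t-\tau)\Delta}\left(\zeta(\tau)\mathbf{w}\right)d\tau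 .$$ (b) If $\alpha>0$: let $\nu(x)=(1+|x|)^{\frac{\alpha}{p-1}}$ and $C_\nu(\mathbb{R}^N)=\{\varphi\in C(\mathbb{R}^N):\|\nu\varphi\|_{L^\infty}<\infty\}$ with norm $\|\nu\varphi\|_{L^\infty}$; then $u_0\in C_\nu(\mathbb{R}^N)$, $u\in L^\infty([0,T];C_\nu(\mathbb{R}^N))$ for every $T>0$, and $u$ is a classical solution, i.e. $u$ is continuous on $[0,\infty)\times\mathbb{R}^N$, $u_t$ and $\partial_{x_i}\partial_{x_j}u$ are continuous on $(0,\infty)\times\mathbb{R}^N$, the equation holds pointwise there, and $u(0,\cdot)=u_0$. *)

theory Defs
  imports "HOL-Analysis.Analysis"
begin

definition heat_kernel :: "real \<Rightarrow> real ^ 'n \<Rightarrow> real" where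
  "heat_kernel t x =
     (4 * pi * t) powr (- (real CARD('n) / 2)) * exp (- (norm x)\<^sup>2 / (4 * t))"

definition heat_semigroup :: "real \<Rightarrow> (real ^ 'n \<Rightarrow> real) \<Rightarrow> real ^ 'n \<Rightarrow> real" where
  "heat_semigroup t \<phi> x =
     (if t = 0 then \<phi> x else (LINT y|lborel. heat_kernel t (x - y) * \<phi> y))"

definition heat_convergent :: "real \<Rightarrow> (real ^ 'n \<Rightarrow> real) \<Rightarrow> real ^ 'n \<Rightarrow> bool" where
  "heat_convergent t \<phi> x \<longleftrightarrow> t = 0 \<or> integrable lborel (\<lambda>y. heat_kernel t (x - y) * \<phi> y)"

definition duhamel :: "(real \<Rightarrow> real ^ 'n \<Rightarrow> real) \<Rightarrow> real \<Rightarrow> real ^ 'n \<Rightarrow> real" where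
  "duhamel f t x = (LINT \<tau>:{0<..<t}|lborel. heat_semigroup (t - \<tau>) (f \<tau>) x)"

text \<open>The Bochner integral of a non-integrable function is 0, so convergence of the space
  integral (for almost every time) and of the time integral has to be required separately.\<close>

definition duhamel_convergent :: "(real \<Rightarrow> real ^ 'n \<Rightarrow> real) \<Rightarrow> real \<Rightarrow> real ^ 'n \<Rightarrow> bool" where
  "duhamel_convergent f t x \<longleftrightarrow>
     (AE \<tau> in lborel. \<tau> \<in> {0<..<t} \<longrightarrow> heat_convergent (t - \<tau>) (f \<tau>) x) \<and>
     set_integrable lborel {0<..<t} (\<lambda>\<tau>. heat_semigroup (t - \<tau>) (f \<tau>) x)"

definition C0 :: "(real ^ 'n \<Rightarrow> real) set" where
  "C0 = {\<phi>. continuous_on UNIV \<phi> \<and> (\<phi> \<longlongrightarrow> 0) at_infinity}"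

definition CB_on :: "'a::topological_space set \<Rightarrow> ('a \<Rightarrow> real) set" where
  "CB_on S = {\<phi>. continuous_on S \<phi> \<and> bounded (\<phi> ` S)}"

definition \<zeta> :: "real \<Rightarrow> real \<Rightarrow> real \<Rightarrow> real" where
  "\<zeta> \<sigma> m t = (if t < 1 then t powr \<sigma> else t powr m)"

text \<open>Since \<^term>\<open>0 powr a = 0\<close> for every \<open>a\<close>, the weight \<^term>\<open>norm x powr \<alpha>\<close> has the value 0 at
  the origin also if \<open>\<alpha> \<le> 0\<close>. It then occurs only under space integrals, where the
  origin is negligible. The same applies to \<^term>\<open>\<zeta> \<sigma> m 0\<close>.\<close>

definition mild_solution ::
  "real \<Rightarrow> real \<Rightarrow> (real \<Rightarrow> real) \<Rightarrow> (real ^ 'n \<Rightarrow> real) \<Rightarrow> (real ^ 'n \<Rightarrow> real) \<Rightarrow>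
   (real \<Rightarrow> real ^ 'n \<Rightarrow> real) \<Rightarrow> bool" where
  "mild_solution \<alpha> p z w u0 u \<longleftrightarrow>
     (\<forall>t\<ge>0. \<forall>x.
        heat_convergent t u0 x \<and>
        duhamel_convergent (\<lambda>\<tau> y. norm y powr \<alpha> * \<bar>u \<tau> y\<bar> powr p) t x \<and>
        duhamel_convergent (\<lambda>\<tau> y. z \<tau> * w y) t x \<and>
        u t x = heat_semigroup t u0 x
              + duhamel (\<lambda>\<tau> y. norm y powr \<alpha> * \<bar>u \<tau> y\<bar> powr p) t x
              + duhamel (\<lambda>\<tau> y. z \<tau> * w y) t x)"

definition \<nu> :: "real \<Rightarrow> real \<Rightarrow> real ^ 'n \<Rightarrow> real" where
  "\<nu> \<alpha> p x = (1 + norm x) powr (\<alpha> / (p - 1))"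

definition C_nu :: "real \<Rightarrow> real \<Rightarrow> (real ^ 'n \<Rightarrow> real) set" where
  "C_nu \<alpha> p = {\<phi>. continuous_on UNIV \<phi> \<and> bounded (range (\<lambda>x. \<nu> \<alpha> p x * \<phi> x))}"

definition strongly_measurable :: "'a measure \<Rightarrow> ('a \<Rightarrow> 'b::topological_space) \<Rightarrow> bool" where
  "strongly_measurable M f \<longleftrightarrow>
     (\<exists>s. (\<forall>k::nat. simple_function M (s k)) \<and> (AE t in M. (\<lambda>k. s k t) \<longlonglongrightarrow> f t))"

text \<open>The Bochner space \<open>L\<^sup>\<infinity>([0,T]; C\<^sub>\<nu>)\<close>. Multiplication by \<open>\<nu>\<close> is an isometric isomorphism
  from \<open>C\<^sub>\<nu>\<close> onto the Banach space of bounded continuous functions, so that \<open>U t\<close> below is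
  the element \<open>u(t)\<close> of \<open>C\<^sub>\<nu>\<close>, and \<^term>\<open>norm (U t)\<close> is its norm in \<open>C\<^sub>\<nu>\<close>.\<close>

definition Linf_C_nu ::
  "real \<Rightarrow> real \<Rightarrow> real \<Rightarrow> (real \<Rightarrow> real ^ 'n \<Rightarrow> real) set" where
  "Linf_C_nu T \<alpha> p =
     {u. \<exists>U :: real \<Rightarrow> (real ^ 'n) \<Rightarrow>\<^sub>C real.
           strongly_measurable (lebesgue_on {0..T}) U \<and>
           (AE t in lebesgue_on {0..T}. \<forall>x. apply_bcontfun (U t) x = \<nu> \<alpha> p x * u t x) \<and>
           (\<exists>K. AE t in lebesgue_on {0..T}. norm (U t) \<le> K)}"

definition has_partial :: "'n \<Rightarrow> (real ^ 'n \<Rightarrow> real) \<Rightarrow> real ^ 'n \<Rightarrow> bool" where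
  "has_partial i f x \<longleftrightarrow> (\<lambda>h::real. f (x + h *\<^sub>R axis i 1)) differentiable (at 0)"

definition partial :: "'n \<Rightarrow> (real ^ 'n \<Rightarrow> real) \<Rightarrow> real ^ 'n \<Rightarrow> real" where
  "partial i f x = deriv (\<lambda>h::real. f (x + h *\<^sub>R axis i 1)) 0"

definition laplacian :: "(real ^ 'n \<Rightarrow> real) \<Rightarrow> real ^ 'n \<Rightarrow> real" where
  "laplacian f x = (\<Sum>i\<in>UNIV. partial i (partial i f) x)"

definition classical_solution ::
  "real \<Rightarrow> real \<Rightarrow> (real \<Rightarrow> real) \<Rightarrow> (real ^ 'n \<Rightarrow> real) \<Rightarrow> (real ^ 'n \<Rightarrow> real) \<Rightarrow>
   (real \<Rightarrow> real ^ 'n \<Rightarrow> real) \<Rightarrow> bool" where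
  "classical_solution \<alpha> p z w u0 u \<longleftrightarrow>
     continuous_on ({0..} \<times> UNIV) (\<lambda>(t, x). u t x) \<and>
     (\<forall>t>0. \<forall>x. (\<lambda>s. u s x) differentiable (at t)) \<and>
     continuous_on ({0<..} \<times> UNIV) (\<lambda>(t, x). deriv (\<lambda>s. u s x) t) \<and>
     (\<forall>t>0. \<forall>x. \<forall>j. has_partial j (u t) x) \<and>
     (\<forall>t>0. \<forall>x. \<forall>i j. has_partial i (partial j (u t)) x) \<and>
     (\<forall>i j. continuous_on ({0<..} \<times> UNIV) (\<lambda>(t, x). partial i (partial j (u t)) x)) \<and>
     (\<forall>t>0. \<forall>x. deriv (\<lambda>s. u s x) t - laplacian (u t) x
                    = norm x powr \<alpha> * \<bar>u t x\<bar> powr p + z t * w x) \<and>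
     (\<forall>x. u 0 x = u0 x)"

definition global_solution ::
  "real \<Rightarrow> real \<Rightarrow> (real \<Rightarrow> real) \<Rightarrow> (real ^ 'n \<Rightarrow> real) \<Rightarrow> (real ^ 'n \<Rightarrow> real) \<Rightarrow>
   (real \<Rightarrow> real ^ 'n \<Rightarrow> real) \<Rightarrow> bool" where
  "global_solution \<alpha> p z w u0 u \<longleftrightarrow>
     (if \<alpha> \<le> 0 then
        u0 \<in> CB_on UNIV \<and>
        (\<forall>T>0. (\<lambda>(t, x). u t x) \<in> CB_on ({0..T} \<times> UNIV)) \<and>
        mild_solution \<alpha> p z w u0 u
      else
        u0 \<in> C_nu \<alpha> p \<and>
        (\<forall>T>0. u \<in> Linf_C_nu T \<alpha> p) \<and>
        classical_solution \<alpha> p z w u0 u)"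

end

theory Submission
  imports Defs "HOL-Probability.Probability"
begin

text \<open>
  Let \<open>\<psi> \<ge> 0\<close> be a \<open>C\<^sup>2\<close> function whose compact support avoids the origin, with
  \<open>\<bar>\<Delta>\<psi>\<bar> \<le> C \<psi>\<^sup>1\<^sup>/\<^sup>p\<close> and \<open>\<integral>w \<psi> > 0\<close>. The energy \<open>F(t) = \<integral>u(t) \<psi>\<close> satisfies
  \<open>F' = \<integral>(u \<Delta>\<psi> + |x|\<^sup>\<alpha> |u|\<^sup>p \<psi>) + \<zeta>(t) \<integral>w \<psi>\<close>. On the support the weight \<open>|x|\<^sup>\<alpha>\<close> is bounded below,
  so by the inequalities of Young and Jensen \<open>F' \<ge> c |F|\<^sup>p - D + \<zeta>(t) \<integral>w \<psi>\<close>. Since \<open>\<zeta>(t) = t\<^sup>m\<close> is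
  unbounded, \<open>F' \<ge> c |F|\<^sup>p + 1\<close> for large \<open>t\<close>, and \<open>F\<close> blows up in finite time.
  For classical solutions the identity for \<open>F'\<close> is integration by parts. For mild solutions it
  follows from Fubini's theorem and \<open>e\<^sup>t\<^sup>\<Delta>\<psi> - \<psi> = \<integral>\<^sub>0\<^sup>t e\<^sup>s\<^sup>\<Delta>\<Delta>\<psi> ds\<close>, with the sign of the source giving
  the absolute convergence.
\<close>

section \<open>Second differences and integration by parts\<close>

text \<open>The weight |x|^\<alpha> is singular at the origin for \<alpha> < 0 and degenerates there
  for \<alpha> > 0; a test function that vanishes near the origin treats all \<alpha> alike, and
  cutting out a small ball changes the integral of w only slightly. The test function stays fixed
  while time grows: t^m outgrows the constant D, so there is no rescaling in space and no balance of
  exponents, and every p > 1 is covered. The exponent 1/p in the bound for \<Delta>\<psi> is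
  dictated by Young's inequality: |u \<Delta>\<psi>| is at most C (|u|^p \<psi>)^(1/p), which a
  fraction of |x|^\<alpha> |u|^p \<psi> absorbs up to a constant on the support. The obstacle lies
  in mild solutions. They come with no derivatives, and a bound on u does not bound the heat
  potential of |x|^\<alpha> |u|^p, because for \<alpha> \<le> -N the weight is not even locally
  integrable. That potential is bounded instead as u minus two bounded terms, and the heat kernel is
  then moved onto \<psi>, where all smoothness is available.\<close>

text \<open>Continuity is recorded for the second derivative alone; the first derivative is only
  differentiable along \<open>e\<close>. This is what iterated partial derivatives provide and all
  that second differences consume.\<close>

definition twice_diff_along :: "'a::real_normed_vector \<Rightarrow> ('a \<Rightarrow> real) \<Rightarrow> ('a \<Rightarrow> real) \<Rightarrow> bool" where
  "twice_diff_along e g g2 \<longleftrightarrow> continuous_on UNIV g2 \<and>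
     (\<exists>g1. \<forall>x. ((\<lambda>h. g (x + h *\<^sub>R e)) has_real_derivative g1 x) (at 0) \<and>
               ((\<lambda>h. g1 (x + h *\<^sub>R e)) has_real_derivative g2 x) (at 0))"

lemma DERIV_along_shift:
  fixes e :: "'a::real_normed_vector"
  assumes "\<And>x. ((\<lambda>h. g (x + h *\<^sub>R e)) has_real_derivative g' x) (at 0)"
  shows "((\<lambda>h. g (x + h *\<^sub>R e)) has_real_derivative g' (x + s *\<^sub>R e)) (at s)"
proof -
  have "((\<lambda>h. g ((x + s *\<^sub>R e) + h *\<^sub>R e)) has_real_derivative g' (x + s *\<^sub>R e)) (at 0)"
    by (rule assms)
  then have "((\<lambda>h. g (x + (h + s) *\<^sub>R e)) has_real_derivative g' (x + s *\<^sub>R e)) (at 0)"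
    by (simp add: algebra_simps)
  then show ?thesis
    using DERIV_shift[of "\<lambda>h. g (x + h *\<^sub>R e)" "g' (x + s *\<^sub>R e)" 0 s] by (simp add: algebra_simps)
qed

text \<open>The symmetric quotient is its own adjoint for Lebesgue measure, so integrating by parts
  twice becomes a translation of variables followed by a limit.\<close>

definition second_diff :: "'a::real_normed_vector \<Rightarrow> real \<Rightarrow> ('a \<Rightarrow> real) \<Rightarrow> 'a \<Rightarrow> real" where
  "second_diff e h g x = (g (x + h *\<^sub>R e) - 2 * g x + g (x - h *\<^sub>R e)) / h\<^sup>2"

text \<open>Taylor expansion with Lagrange remainder at h and at -h; the first-order terms cancel in
  the sum and the two remainders are left.\<close>

lemma second_diff_mean_value:
  fixes e :: "'a::real_normed_vector"
  assumes "twice_diff_along e g g2" "h > 0"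
  obtains s t where "\<bar>s\<bar> \<le> h" "\<bar>t\<bar> \<le> h"
    "second_diff e h g x = (g2 (x + s *\<^sub>R e) + g2 (x + t *\<^sub>R e)) / 2"
proof -
  obtain g1 where
    1: "\<And>x. ((\<lambda>h. g (x + h *\<^sub>R e)) has_real_derivative g1 x) (at 0)" and
    2: "\<And>x. ((\<lambda>h. g1 (x + h *\<^sub>R e)) has_real_derivative g2 x) (at 0)"
    using assms(1) unfolding twice_diff_along_def by blast
  \<comment> \<open>The list of derivatives along the line through \<open>x\<close>, in the shape
    that Taylor's theorem expects; \<open>m\<close> is the order.\<close>
  define D where "D m s = (if m = 0 then g (x + s *\<^sub>R e)
      else if m = 1 then g1 (x + s *\<^sub>R e) else g2 (x + s *\<^sub>R e))" for m :: nat and s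
  have D: "\<forall>m s. m < 2 \<and> - h \<le> s \<and> s \<le> h \<longrightarrow> DERIV (D m) s :> D (Suc m) s"
    using DERIV_along_shift[of g e g1, OF 1] DERIV_along_shift[of g1 e g2, OF 2]
    by (auto simp: D_def[abs_def] less_2_cases_iff)
  have *: "\<exists>t. \<bar>t\<bar> \<le> h \<and> g (x + y *\<^sub>R e) = g x + g1 x * y + g2 (x + t *\<^sub>R e) / 2 * y\<^sup>2"
    if y: "y = h \<or> y = - h" for y
  proof -
    obtain t where "if y < 0 then y < t \<and> t < 0 else 0 < t \<and> t < y"
      "D 0 y = (\<Sum>m<2. D m 0 / fact m * (y - 0) ^ m) + D 2 t / fact 2 * (y - 0)\<^sup>2"
      using Taylor[of 2 D "D 0" "- h" h 0 y, OF _ refl D] y \<open>h > 0\<close> by force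
    then show ?thesis
      using y \<open>h > 0\<close> by (intro exI[of _ t]) (auto simp: D_def numeral_2_eq_2 split: if_splits)
  qed
  obtain s where s: "\<bar>s\<bar> \<le> h" "g (x + h *\<^sub>R e) = g x + g1 x * h + g2 (x + s *\<^sub>R e) / 2 * h\<^sup>2"
    using * by blast
  obtain t where t: "\<bar>t\<bar> \<le> h" "g (x + (- h) *\<^sub>R e) = g x + g1 x * (- h) + g2 (x + t *\<^sub>R e) / 2 * (- h)\<^sup>2"
    using * by blast
  have "second_diff e h g x = (g2 (x + s *\<^sub>R e) + g2 (x + t *\<^sub>R e)) / 2"
    using s t \<open>h > 0\<close> by (simp add: second_diff_def divide_simps) (simp add: algebra_simps)
  with s t that show ?thesis by blast
qed

lemma second_diff_tendsto:
  fixes e :: "'a::real_normed_vector"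
  assumes g: "twice_diff_along e g g2" and h: "\<And>n. h n > 0" "h \<longlonglongrightarrow> 0"
  shows "(\<lambda>n. second_diff e (h n) g x) \<longlonglongrightarrow> g2 x"
proof -
  have "\<exists>s t. \<bar>s\<bar> \<le> h n \<and> \<bar>t\<bar> \<le> h n \<and>
      second_diff e (h n) g x = (g2 (x + s *\<^sub>R e) + g2 (x + t *\<^sub>R e)) / 2" for n
    using second_diff_mean_value[OF g h(1)] by metis
  then obtain s t where st: "\<And>n. \<bar>s n\<bar> \<le> h n" "\<And>n. \<bar>t n\<bar> \<le> h n"
      "\<And>n. second_diff e (h n) g x = (g2 (x + s n *\<^sub>R e) + g2 (x + t n *\<^sub>R e)) / 2"
    by metis
  have "s \<longlonglongrightarrow> 0" "t \<longlonglongrightarrow> 0"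
    using st h(2) by (auto intro!: Lim_null_comparison[of _ h] always_eventually)
  moreover have "isCont g2 x"
    using g by (auto simp: twice_diff_along_def continuous_on_eq_continuous_at)
  ultimately have "(\<lambda>n. (g2 (x + s n *\<^sub>R e) + g2 (x + t n *\<^sub>R e)) / 2) \<longlonglongrightarrow> (g2 x + g2 x) / 2"
    by (intro tendsto_intros isCont_tendsto_compose[of x g2]) (auto intro!: tendsto_eq_intros)
  then show ?thesis by (simp add: st(3))
qed

lemma integrable_compact_support:
  fixes f :: "'a::euclidean_space \<Rightarrow> real"
  assumes "continuous_on UNIV f" "compact K" "\<And>x. x \<notin> K \<Longrightarrow> f x = 0"
  shows "integrable lborel f"
proof -
  have "(\<lambda>x. indicator K x *\<^sub>R f x) = f"
    using assms(3) by (auto simp: indicator_def fun_eq_iff)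
  then show ?thesis
    using borel_integrable_compact[OF assms(2) continuous_on_subset[OF assms(1)], of] by simp
qed

text \<open>The Leibniz rule and continuity in a parameter are applied to integrals over a box; this
  is the passage to them.\<close>

lemma integral_lborel_compact_support:
  fixes f :: "'a::euclidean_space \<Rightarrow> real"
  assumes "continuous_on UNIV f" "compact K" "K \<subseteq> cbox a b" "\<And>x. x \<notin> K \<Longrightarrow> f x = 0"
  shows "(LINT x|lborel. f x) = integral (cbox a b) f"
proof -
  have "(LINT x|lborel. f x) = integral UNIV f"
    using integrable_compact_support[OF assms(1,2,4)] by (simp add: integral_lborel)
  also have "\<dots> = integral UNIV (\<lambda>x. if x \<in> cbox a b then f x else 0)"
    using assms(3,4) by (intro integral_cong) auto
  also have "\<dots> = integral (cbox a b) f"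
    by (rule integral_restrict_UNIV)
  finally show ?thesis .
qed

lemma integrable_translate:
  fixes f :: "'a::euclidean_space \<Rightarrow> real"
  assumes "integrable lborel f"
  shows "integrable lborel (\<lambda>x. f (x + c))"
  using assms integrable_distr_eq[of "\<lambda>x. c + x" lborel borel f]
  by (simp add: lborel_distr_plus) (simp add: add.commute)

lemma integral_translate:
  fixes f :: "'a::euclidean_space \<Rightarrow> real"
  assumes [measurable]: "f \<in> borel_measurable borel"
  shows "(LINT x|lborel. f (x + c)) = (LINT x|lborel. f x)"
  using integral_distr[of "\<lambda>x. c + x" lborel borel f]
  by (simp add: lborel_distr_plus) (simp add: add.commute)

lemma integral_second_diff:
  fixes g \<psi> :: "'a::euclidean_space \<Rightarrow> real"
  assumes g: "continuous_on UNIV g" and \<psi>: "continuous_on UNIV \<psi>"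
    and K: "compact K" "\<And>x. x \<notin> K \<Longrightarrow> \<psi> x = 0"
  shows "(LINT x|lborel. second_diff e h g x * \<psi> x) = (LINT x|lborel. g x * second_diff e h \<psi> x)"
proof -
  note [continuous_intros] = continuous_on_compose2[OF g] continuous_on_compose2[OF \<psi>]
  have i: "integrable lborel (\<lambda>x. g (x + c) * \<psi> x)" for c
    by (rule integrable_compact_support[OF _ K(1)]) (auto intro!: continuous_intros simp: K)
  \<comment> \<open>Written this way, the integrand is the translate by -c of
    \<open>g (x + c) * \<psi> x\<close>, which has compact support.\<close>
  have eq: "g x * \<psi> (x + (- c)) = g ((x + (- c)) + c) * \<psi> (x + (- c))" for x c by simp
  have j: "integrable lborel (\<lambda>x. g x * \<psi> (x + (- c)))" for c
    unfolding eq by (rule integrable_translate[OF i])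
  have b: "(\<lambda>x. g (x + c) * \<psi> x) \<in> borel_measurable borel" for c
    by (intro borel_measurable_continuous_onI continuous_intros) auto
  have k: "(LINT x|lborel. g x * \<psi> (x + (- c))) = (LINT x|lborel. g (x + c) * \<psi> x)" for c
    unfolding eq by (rule integral_translate[OF b])
  have "(LINT x|lborel. second_diff e h g x * \<psi> x) =
     (LINT x|lborel. (g (x + h *\<^sub>R e) * \<psi> x - 2 * (g (x + 0) * \<psi> x) + g (x + (- h *\<^sub>R e)) * \<psi> x) / h\<^sup>2)"
    by (intro Bochner_Integration.integral_cong) (auto simp: second_diff_def field_simps)
  also have "\<dots> = ((LINT x|lborel. g (x + h *\<^sub>R e) * \<psi> x) - 2 * (LINT x|lborel. g (x + 0) * \<psi> x) +
      (LINT x|lborel. g (x + (- h *\<^sub>R e)) * \<psi> x)) / h\<^sup>2"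
    using i[of "h *\<^sub>R e"] i[of 0] i[of "- h *\<^sub>R e"] by simp
  also have "\<dots> = ((LINT x|lborel. g x * \<psi> (x + (- (h *\<^sub>R e)))) - 2 * (LINT x|lborel. g x * \<psi> (x + (- 0))) +
      (LINT x|lborel. g x * \<psi> (x + (- (- h *\<^sub>R e))))) / h\<^sup>2"
    by (simp only: k)
  also have "\<dots> = (LINT x|lborel. (g x * \<psi> (x + (- (h *\<^sub>R e))) - 2 * (g x * \<psi> (x + (- 0))) + g x * \<psi> (x + (- (- h *\<^sub>R e)))) / h\<^sup>2)"
    using j[of "h *\<^sub>R e"] j[of 0] j[of "- h *\<^sub>R e"] by simp
  also have "\<dots> = (LINT x|lborel. g x * second_diff e h \<psi> x)"
    by (intro Bochner_Integration.integral_cong) (auto simp: second_diff_def field_simps)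
  finally show ?thesis .
qed

text \<open>Near a point outside the closed set \<open>K\<close>, sufficiently short second
  differences only see zeros, and so does their limit.\<close>

lemma twice_diff_along_support:
  fixes \<psi> :: "'a::real_normed_vector \<Rightarrow> real"
  assumes \<psi>: "twice_diff_along e \<psi> \<psi>2" and K: "closed K" "\<And>x. x \<notin> K \<Longrightarrow> \<psi> x = 0" and x: "x \<notin> K"
  shows "\<psi>2 x = 0"
proof -
  have "eventually (\<lambda>y. y \<in> - K) (nhds x)"
    using K(1) x by (intro eventually_nhds_in_open) auto
  then obtain d where d: "d > 0" "\<And>y. dist y x < d \<Longrightarrow> y \<notin> K"
    by (auto simp: eventually_nhds_metric)
  \<comment> \<open>Steps with h * norm e < d, so that x + h e and x - h e stay in the ball that
    avoids \<open>K\<close>; the summand 1 avoids division by zero for e = 0.\<close>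
  define h where "h n = (d / (norm e + 1) / 2) * inverse (real (Suc n))" for n
  have ne: "norm e + 1 > 0" by (simp add: add_nonneg_pos)
  have h: "h n > 0" for n using d(1) ne by (simp add: h_def)
  have "(\<lambda>n. (d / (norm e + 1) / 2) * inverse (real (Suc n))) \<longlonglongrightarrow> (d / (norm e + 1) / 2) * 0"
    by (intro tendsto_intros LIMSEQ_inverse_real_of_nat)
  then have lim: "h \<longlonglongrightarrow> 0" unfolding h_def[abs_def] by simp
  have small: "h n * norm e < d" for n
  proof -
    have "h n \<le> (d / (norm e + 1) / 2) * 1"
      unfolding h_def using d(1) ne by (intro mult_left_mono) (simp_all add: inverse_le_1_iff)
    then have "h n * norm e \<le> d / (norm e + 1) / 2 * norm e"
      by (intro mult_right_mono) auto
    also have "\<dots> = d * (norm e / (norm e + 1) / 2)" by simp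
    also have "\<dots> < d * 1"
      using d(1) ne by (intro mult_strict_left_mono) (auto simp: divide_simps)
    also have "\<dots> = d" by simp
    finally show ?thesis .
  qed
  have "second_diff e (h n) \<psi> x = 0" for n
  proof -
    have "\<psi> (x + h n *\<^sub>R e) = 0" "\<psi> (x - h n *\<^sub>R e) = 0" "\<psi> x = 0"
      using small[of n] h[of n] d by (auto intro!: K(2) d(2) simp: dist_norm)
    then show ?thesis by (simp add: second_diff_def)
  qed
  then show ?thesis
    using second_diff_tendsto[OF \<psi> h lim, of x] by (simp add: LIMSEQ_const_iff)
qed

text \<open>Dominated convergence, with the mean value form as majorant. The hypothesis
  \<open>supp\<close> is phrased for the product because it serves two cases: the factor
  \<open>f\<close> has compact support, or the differenced function has.\<close>

lemma second_diff_integral_tendsto: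
  fixes g f :: "'a::euclidean_space \<Rightarrow> real"
  assumes g: "continuous_on UNIV g" and g2: "twice_diff_along e g g2"
    and f: "continuous_on UNIV f" and K: "compact K"
    and supp: "\<And>x h. x \<notin> K \<Longrightarrow> 0 < h \<Longrightarrow> h \<le> 1 \<Longrightarrow> f x * second_diff e h g x = 0"
  shows "(\<lambda>n. LINT x|lborel. f x * second_diff e (inverse (real (Suc n))) g x) \<longlonglongrightarrow>
    (LINT x|lborel. f x * g2 x)"
proof -
  have g2c: "continuous_on UNIV g2" using g2 by (simp add: twice_diff_along_def)
  note [continuous_intros] = continuous_on_compose2[OF g] continuous_on_compose2[OF g2c] continuous_on_compose2[OF f]
  \<comment> \<open>Contains every point where the mean value form evaluates \<open>g2\<close> for a
    base point in \<open>K\<close>, as all steps are at most 1.\<close>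
  define K' where "K' = (\<lambda>(x, s). x + s *\<^sub>R e) ` (K \<times> {-1..1::real})"
  have "compact K'"
    unfolding K'_def using K
    by (intro compact_continuous_image compact_Times) (auto simp: case_prod_beta intro!: continuous_intros)
  then have "bounded (g2 ` K')"
    by (intro compact_imp_bounded compact_continuous_image continuous_on_subset[OF g2c]) auto
  then obtain B where B: "\<And>x. x \<in> K' \<Longrightarrow> \<bar>g2 x\<bar> \<le> B" by (auto simp: bounded_iff)
  define h where "h n = inverse (real (Suc n))" for n
  have h: "h n > 0" "h n \<le> 1" "h \<longlonglongrightarrow> 0" for n
    unfolding h_def using LIMSEQ_inverse_real_of_nat by (simp_all add: inverse_le_1_iff)
  have lim: "(\<lambda>n. f x * second_diff e (h n) g x) \<longlonglongrightarrow> f x * g2 x" for x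
    using second_diff_tendsto[OF g2 h(1,3)] by (intro tendsto_intros) auto
  have bd: "\<bar>f x * second_diff e (h n) g x\<bar> \<le> indicator K x *\<^sub>R (\<bar>f x\<bar> * B)" for n x
  proof (cases "x \<in> K")
    case True
    obtain s t where st: "\<bar>s\<bar> \<le> h n" "\<bar>t\<bar> \<le> h n"
        "second_diff e (h n) g x = (g2 (x + s *\<^sub>R e) + g2 (x + t *\<^sub>R e)) / 2"
      using second_diff_mean_value[OF g2 h(1)] by metis
    have "x + r *\<^sub>R e \<in> K'" if "\<bar>r\<bar> \<le> h n" for r
      using that h(2)[of n] True unfolding K'_def by (intro image_eqI[of _ _ "(x, r)"]) auto
    from this[OF st(1)] this[OF st(2)] have "\<bar>second_diff e (h n) g x\<bar> \<le> B"
      unfolding st(3) by (auto dest!: B simp: abs_le_iff)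
    then show ?thesis using True by (auto simp: abs_mult intro!: mult_left_mono)
  next
    case False
    then show ?thesis using supp[OF False h(1,2)] by simp
  qed
  have "(\<lambda>n. LINT x|lborel. f x * second_diff e (h n) g x) \<longlonglongrightarrow> (LINT x|lborel. f x * g2 x)"
  proof (rule integral_dominated_convergence[where w = "\<lambda>x. indicator K x *\<^sub>R (\<bar>f x\<bar> * B)"])
    show "integrable lborel (\<lambda>x. indicator K x *\<^sub>R (\<bar>f x\<bar> * B))"
      by (intro borel_integrable_compact K continuous_intros) auto
    have "(\<lambda>x. f x * g2 x) \<in> borel_measurable borel"
      by (intro borel_measurable_continuous_onI continuous_intros) auto
    then show "(\<lambda>x. f x * g2 x) \<in> borel_measurable lborel" by simp
    have "(\<lambda>x. f x * second_diff e (h n) g x) \<in> borel_measurable borel" for n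
      unfolding second_diff_def using h(1)[of n]
      by (intro borel_measurable_continuous_onI continuous_intros) auto
    then show "(\<lambda>x. f x * second_diff e (h n) g x) \<in> borel_measurable lborel" for n by simp
  qed (use lim bd in auto)
  then show ?thesis by (simp add: h_def)
qed

text \<open>The identity holds exactly for second differences by translation invariance, and both
  sides converge as the step tends to 0.\<close>

lemma integral_by_parts_twice:
  fixes g \<psi> :: "'a::euclidean_space \<Rightarrow> real"
  assumes g: "continuous_on UNIV g" "twice_diff_along e g g2"
    and \<psi>: "continuous_on UNIV \<psi>" "twice_diff_along e \<psi> \<psi>2"
    and K: "compact K" "\<And>x. x \<notin> K \<Longrightarrow> \<psi> x = 0"
  shows "(LINT x|lborel. g2 x * \<psi> x) = (LINT x|lborel. g x * \<psi>2 x)"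
proof -
  \<comment> \<open>Differencing enlarges the support of \<psi>: with steps at most 1 it remains
    within this compact set.\<close>
  define K' where "K' = (\<lambda>(x, s). x + s *\<^sub>R e) ` (K \<times> {-1..1::real})"
  have K': "compact K'"
    unfolding K'_def using K(1)
    by (intro compact_continuous_image compact_Times) (auto simp: case_prod_beta intro!: continuous_intros)
  have zero: "second_diff e h \<psi> x = 0" if "x \<notin> K'" "0 < h" "h \<le> 1" for x h
  proof -
    have "x + s *\<^sub>R e \<notin> K" if "\<bar>s\<bar> \<le> 1" for s
    proof
      assume "x + s *\<^sub>R e \<in> K"
      then have "(x + s *\<^sub>R e) + (- s) *\<^sub>R e \<in> K'"
        unfolding K'_def using that by (intro image_eqI[of _ _ "(x + s *\<^sub>R e, - s)"]) auto
      then show False using \<open>x \<notin> K'\<close> by simp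
    qed
    from this[of h] this[of "-h"] this[of 0] show ?thesis using that by (simp add: second_diff_def K(2))
  qed
  have "(\<lambda>n. LINT x|lborel. \<psi> x * second_diff e (inverse (real (Suc n))) g x) \<longlonglongrightarrow> (LINT x|lborel. \<psi> x * g2 x)"
    by (rule second_diff_integral_tendsto[OF g \<psi>(1) K(1)]) (simp add: K(2))
  moreover have "(\<lambda>n. LINT x|lborel. g x * second_diff e (inverse (real (Suc n))) \<psi> x) \<longlonglongrightarrow> (LINT x|lborel. g x * \<psi>2 x)"
    by (rule second_diff_integral_tendsto[OF \<psi> g(1) K']) (simp add: zero)
  moreover have "(LINT x|lborel. \<psi> x * second_diff e h g x) = (LINT x|lborel. g x * second_diff e h \<psi> x)" for h
    using integral_second_diff[OF g(1) \<psi>(1) K] by (simp add: mult.commute)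
  ultimately show ?thesis by (auto dest: LIMSEQ_unique simp: mult.commute)
qed

section \<open>The Laplacian and the heat kernel\<close>

text \<open>A relation rather than a use of \<open>laplacian\<close>, so that kernels and cutoffs
  can carry explicit formulas. The summands \<open>D i\<close> stay accessible, since integration by
  parts is done one axis at a time.\<close>

definition has_laplacian :: "(real ^ 'n \<Rightarrow> real) \<Rightarrow> (real ^ 'n \<Rightarrow> real) \<Rightarrow> bool" where
  "has_laplacian g L \<longleftrightarrow> continuous_on UNIV g \<and>
     (\<exists>D. (\<forall>i. twice_diff_along (axis i 1) g (D i)) \<and> L = (\<lambda>x. \<Sum>i\<in>UNIV. D i x))"

lemma has_laplacian_continuous:
  assumes "has_laplacian g L"
  shows "continuous_on UNIV g" "continuous_on UNIV L"
  using assms by (auto simp: has_laplacian_def twice_diff_along_def intro!: continuous_intros)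

lemma has_laplacian_support:
  assumes "has_laplacian g L" "closed K" "\<And>x. x \<notin> K \<Longrightarrow> g x = 0" "x \<notin> K"
  shows "L x = 0"
proof -
  obtain D where "\<And>i. twice_diff_along (axis i 1) g (D i)" "L = (\<lambda>x. \<Sum>i\<in>UNIV. D i x)"
    using assms(1) by (auto simp: has_laplacian_def)
  then show ?thesis
    by (auto intro!: sum.neutral twice_diff_along_support[OF _ assms(2-4)])
qed

text \<open>Compact support of \<psi> removes boundary terms, whatever \<open>g\<close> does at
  infinity.\<close>

lemma green_identity:
  fixes g \<psi> :: "real ^ 'n \<Rightarrow> real"
  assumes g: "has_laplacian g Lg" and \<psi>: "has_laplacian \<psi> L\<psi>"
    and K: "compact K" "\<And>x. x \<notin> K \<Longrightarrow> \<psi> x = 0"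
  shows "(LINT x|lborel. Lg x * \<psi> x) = (LINT x|lborel. g x * L\<psi> x)"
proof -
  obtain D where D: "\<And>i. twice_diff_along (axis i 1) g (D i)" "Lg = (\<lambda>x. \<Sum>i\<in>UNIV. D i x)"
    using g by (auto simp: has_laplacian_def)
  obtain E where E: "\<And>i. twice_diff_along (axis i 1) \<psi> (E i)" "L\<psi> = (\<lambda>x. \<Sum>i\<in>UNIV. E i x)"
    using \<psi> by (auto simp: has_laplacian_def)
  have c: "continuous_on UNIV (D i)" "continuous_on UNIV (E i)" for i
    using D(1)[of i] E(1)[of i] by (auto simp: twice_diff_along_def)
  note cont = has_laplacian_continuous(1)[OF g] has_laplacian_continuous(1)[OF \<psi>]
  note [continuous_intros] = c[THEN continuous_on_compose2] cont[THEN continuous_on_compose2]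
  have E0: "E i x = 0" if "x \<notin> K" for i x
    using twice_diff_along_support[OF E(1) compact_imp_closed[OF K(1)] K(2) that] .
  have i1: "integrable lborel (\<lambda>x. D i x * \<psi> x)" for i
    by (rule integrable_compact_support[OF _ K(1)]) (auto intro!: continuous_intros simp: K)
  have i2: "integrable lborel (\<lambda>x. g x * E i x)" for i
    by (rule integrable_compact_support[OF _ K(1)]) (auto intro!: continuous_intros simp: E0)
  have "(LINT x|lborel. Lg x * \<psi> x) = (\<Sum>i\<in>UNIV. LINT x|lborel. D i x * \<psi> x)"
    by (simp add: D(2) sum_distrib_right i1)
  also have "\<dots> = (\<Sum>i\<in>UNIV. LINT x|lborel. g x * E i x)"
    by (intro sum.cong refl integral_by_parts_twice[OF cont(1) D(1) cont(2) E(1) K])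
  also have "\<dots> = (LINT x|lborel. g x * L\<psi> x)"
    by (simp add: E(2) sum_distrib_left i2)
  finally show ?thesis .
qed

lemma norm_add_axis:
  fixes z :: "real ^ 'n"
  shows "(norm (z + h *\<^sub>R axis i 1))\<^sup>2 = (norm z)\<^sup>2 + 2 * h * (z $ i) + h\<^sup>2"
  unfolding power2_norm_eq_inner
  by (simp add: inner_add_left inner_add_right inner_axis inner_axis' power2_eq_square algebra_simps)

lemma norm_vec_square: "(norm (x :: real ^ 'n))\<^sup>2 = (\<Sum>i\<in>UNIV. (x $ i)\<^sup>2)"
  by (simp add: norm_vec_def L2_set_def sum_nonneg)

text \<open>The profile takes the squared radius, which along each axis is a quadratic polynomial,
  so nothing singular happens at the centre. The i-th second derivative is 4 (x_i - a_i)^2 P'' + 2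
  P', and summing over i gives the formula.\<close>

lemma has_laplacian_radial:
  fixes a :: "real ^ 'n"
  assumes P: "\<And>r. r \<ge> 0 \<Longrightarrow> (P has_real_derivative P' r) (at r)"
    and P': "\<And>r. r \<ge> 0 \<Longrightarrow> (P' has_real_derivative P'' r) (at r)"
    and P'': "continuous_on {0..} P''"
  shows "has_laplacian (\<lambda>x. P ((norm (x - a))\<^sup>2))
    (\<lambda>x. 4 * (norm (x - a))\<^sup>2 * P'' ((norm (x - a))\<^sup>2) + 2 * real CARD('n) * P' ((norm (x - a))\<^sup>2))"
proof -
  define R where "R x = (norm (x - a))\<^sup>2" for x
  have cP: "continuous_on {0..} P" "continuous_on {0..} P'"
    by (rule DERIV_continuous_on[OF has_field_derivative_at_within[OF P]] DERIV_continuous_on[OF has_field_derivative_at_within[OF P']]; simp)+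
  have cR: "continuous_on UNIV R" unfolding R_def by (intro continuous_intros)
  note [continuous_intros] = cP[THEN continuous_on_compose2] continuous_on_compose2[OF P'']
    continuous_on_compose2[OF cR]
  have R0: "R x \<ge> 0" for x by (simp add: R_def)
  have Rs: "((\<lambda>h. R (x + h *\<^sub>R axis i 1)) has_real_derivative 2 * ((x - a) $ i)) (at 0)" for x i
  proof -
    have "R (x + h *\<^sub>R axis i 1) = R x + 2 * h * ((x - a) $ i) + h\<^sup>2" for h
      using norm_add_axis[of "x - a" h i] by (simp add: R_def algebra_simps)
    then show ?thesis by (auto intro!: derivative_eq_intros)
  qed
  have Ri: "((\<lambda>h. (x + h *\<^sub>R axis i 1 - a) $ i) has_real_derivative 1) (at 0)" for x i
    by (auto intro!: derivative_eq_intros)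
  define D where "D i x = 4 * ((x - a) $ i)\<^sup>2 * P'' (R x) + 2 * P' (R x)" for i x
  have d1: "((\<lambda>h. P (R (x + h *\<^sub>R axis i 1))) has_real_derivative P' (R x) * (2 * ((x - a) $ i))) (at 0)" for x i
    by (rule DERIV_chain2[OF _ Rs]) (simp add: P R0)
  have d1': "((\<lambda>h. P' (R (x + h *\<^sub>R axis i 1))) has_real_derivative P'' (R x) * (2 * ((x - a) $ i))) (at 0)" for x i
    by (rule DERIV_chain2[OF _ Rs]) (simp add: P' R0)
  have d2: "((\<lambda>h. P' (R (x + h *\<^sub>R axis i 1)) * (2 * ((x + h *\<^sub>R axis i 1 - a) $ i))) has_real_derivative D i x) (at 0)" for x i
    by (rule DERIV_cong[OF DERIV_mult[OF d1' DERIV_cmult[OF Ri]]]) (simp add: D_def power2_eq_square algebra_simps)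
  have "twice_diff_along (axis i 1) (\<lambda>x. P (R x)) (D i)" for i
    unfolding twice_diff_along_def
  proof (intro conjI exI allI)
    show "continuous_on UNIV (D i)"
      unfolding D_def by (intro continuous_intros) (auto simp: R0)
  qed (rule d1 d2)+
  moreover have "continuous_on UNIV (\<lambda>x. P (R x))" by (intro continuous_intros) (auto simp: R0)
  moreover have "4 * R x * P'' (R x) + 2 * real CARD('n) * P' (R x) = (\<Sum>i\<in>UNIV. D i x)" for x
    unfolding D_def by (simp add: sum.distrib sum_distrib_right[symmetric] sum_distrib_left[symmetric] R_def norm_vec_square)
  ultimately show ?thesis unfolding has_laplacian_def R_def by blast
qed

section \<open>The heat equation for the kernel and for the semigroup\<close>

lemma heat_kernel_nonneg: "heat_kernel t x \<ge> 0"
  by (simp add: heat_kernel_def)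

lemma heat_kernel_commute: "heat_kernel t (x - y) = heat_kernel t (y - x)"
  by (simp add: heat_kernel_def norm_minus_commute)

lemma heat_kernel_measurable [measurable (raw)]:
  assumes [measurable]: "f \<in> borel_measurable M" "g \<in> borel_measurable M"
  shows "(\<lambda>x. heat_kernel (f x) (g x)) \<in> borel_measurable M"
  unfolding heat_kernel_def by measurable

text \<open>The kernel is a Gaussian profile in the squared distance to \<open>x\<close>. The factor
  obtained here agrees with the one in \<open>heat_kernel_DERIV\<close>; that agreement is the heat
  equation.\<close>

lemma heat_kernel_laplacian:
  fixes x :: "real ^ 'n"
  assumes "t > 0"
  shows "has_laplacian (\<lambda>y. heat_kernel t (x - y))
    (\<lambda>y. heat_kernel t (x - y) * ((norm (x - y))\<^sup>2 / (4 * t\<^sup>2) - real CARD('n) / (2 * t)))"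
proof -
  define c where "c = (4 * pi * t) powr (- (real CARD('n) / 2))"
  define P where "P r = c * exp (- r / (4 * t))" for r :: real
  have "has_laplacian (\<lambda>y. P ((norm (y - x))\<^sup>2))
     (\<lambda>y. 4 * (norm (y - x))\<^sup>2 * (P ((norm (y - x))\<^sup>2) / (16 * t\<^sup>2))
        + 2 * real CARD('n) * (- P ((norm (y - x))\<^sup>2) / (4 * t)))"
    by (rule has_laplacian_radial)
      (use assms in \<open>auto simp: P_def power2_eq_square intro!: derivative_eq_intros continuous_intros\<close>)
  moreover have "P ((norm (y - x))\<^sup>2) = heat_kernel t (x - y)" for y
    by (simp add: P_def c_def heat_kernel_def norm_minus_commute)
  moreover have "4 * (norm (y - x))\<^sup>2 * (k / (16 * t\<^sup>2)) + 2 * real CARD('n) * (- k / (4 * t)) =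
      k * ((norm (x - y))\<^sup>2 / (4 * t\<^sup>2) - real CARD('n) / (2 * t))" for k y
    by (simp add: norm_minus_commute field_simps)
  ultimately show ?thesis by (simp only:)
qed

lemma heat_kernel_DERIV:
  fixes z :: "real ^ 'n"
  assumes "t > 0"
  shows "((\<lambda>t. heat_kernel t z) has_real_derivative
     heat_kernel t z * ((norm z)\<^sup>2 / (4 * t\<^sup>2) - real CARD('n) / (2 * t))) (at t)"
proof -
  define d where "d = real CARD('n) / 2"
  have p: "(4 * pi * t) powr (- d - 1) = (4 * pi * t) powr (- d) / (4 * pi * t)"
    using assms by (simp add: powr_diff)
  have "((\<lambda>t. (4 * pi * t) powr (- d)) has_real_derivative (- d * (4 * pi * t) powr (- d - 1) * (4 * pi))) (at t)"
    by (rule DERIV_chain2[OF has_real_derivative_powr]) (use assms in \<open>auto intro!: derivative_eq_intros\<close>)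
  moreover have "((\<lambda>t. exp (- (norm z)\<^sup>2 / (4 * t))) has_real_derivative
      exp (- (norm z)\<^sup>2 / (4 * t)) * ((norm z)\<^sup>2 / (4 * t\<^sup>2))) (at t)"
    using assms by (auto intro!: derivative_eq_intros simp: power2_eq_square field_simps)
  ultimately show ?thesis
    unfolding heat_kernel_def d_def[symmetric]
    by (rule DERIV_cong[OF DERIV_mult]) (use assms p in \<open>simp add: d_def field_simps\<close>)
qed

text \<open>The time derivative falls on the kernel, where it equals the Laplacian in the
  integration variable, and Green's identity moves that Laplacian onto \<psi>.\<close>

lemma heat_semigroup_DERIV:
  fixes \<psi> :: "real ^ 'n \<Rightarrow> real"
  assumes \<psi>: "has_laplacian \<psi> L" and K: "compact K" "\<And>x. x \<notin> K \<Longrightarrow> \<psi> x = 0" and t: "t > 0"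
  shows "((\<lambda>t. heat_semigroup t \<psi> x) has_real_derivative heat_semigroup t L x) (at t)"
proof -
  obtain a b where ab: "K \<subseteq> cbox a b"
    using bounded_subset_cbox_symmetric[OF compact_imp_bounded[OF K(1)]] by blast
  note cont = has_laplacian_continuous[OF \<psi>]
  note [continuous_intros] = cont[THEN continuous_on_compose2]
  let ?g = "\<lambda>t z :: real ^ 'n. (norm z)\<^sup>2 / (4 * t\<^sup>2) - real CARD('n) / (2 * t)"
  have cG: "continuous_on A (\<lambda>y. heat_kernel t (x - y))" if "t > 0" for t A
    using has_laplacian_continuous(1)[OF heat_kernel_laplacian[OF that, of x]] continuous_on_subset by blast
  have eq: "heat_semigroup s \<psi> x = integral (cbox a b) (\<lambda>y. heat_kernel s (x - y) * \<psi> y)" if "s > 0" for s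
    unfolding heat_semigroup_def using that
    by (auto intro!: integral_lborel_compact_support[OF _ K(1) ab] continuous_intros cG simp: K(2))
  let ?G' = "\<lambda>s y. heat_kernel s (x - y) * ?g s (x - y) * \<psi> y"
  have deriv: "((\<lambda>s. heat_kernel s (x - y) * \<psi> y) has_real_derivative ?G' s y) (at s within {0<..})"
    if "s \<in> {0<..}" for s y
    using that
    by (auto intro!: DERIV_cmult_right has_field_derivative_at_within[OF heat_kernel_DERIV])
  have int: "(\<lambda>y. heat_kernel s (x - y) * \<psi> y) integrable_on cbox a b" if "s \<in> {0<..}" for s
    using that by (intro integrable_continuous continuous_intros cG) auto
  have joint: "continuous_on ({0<..} \<times> cbox a b) (\<lambda>(s, y). ?G' s y)"
    unfolding heat_kernel_def case_prod_beta by (intro continuous_intros) auto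
  have "((\<lambda>s. integral (cbox a b) (\<lambda>y. heat_kernel s (x - y) * \<psi> y)) has_field_derivative
      integral (cbox a b) (?G' t)) (at t within {0<..})"
    by (rule leibniz_rule_field_derivative[where fx = ?G', OF deriv int joint]) (use t in auto)
  moreover have "at t within {0<..} = at t"
    using t by (intro at_within_open) auto
  moreover have "integral (cbox a b) (?G' t) = heat_semigroup t L x"
  proof -
    have "integral (cbox a b) (?G' t) = (LINT y|lborel. ?G' t y)"
      by (rule integral_lborel_compact_support[OF _ K(1) ab, symmetric])
        (use t in \<open>auto intro!: continuous_intros cG simp: K(2)\<close>)
    also have "\<dots> = (LINT y|lborel. heat_kernel t (x - y) * L y)"
      by (rule green_identity[OF heat_kernel_laplacian[OF t] \<psi> K])
    finally show ?thesis using t by (simp add: heat_semigroup_def)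
  qed
  ultimately have "((\<lambda>s. integral (cbox a b) (\<lambda>y. heat_kernel s (x - y) * \<psi> y)) has_real_derivative
      heat_semigroup t L x) (at t)"
    by (simp only:)
  then show ?thesis
    by (rule has_field_derivative_transform_within_open[of _ _ _ "{0<..}"]) (use t eq in auto)
qed

section \<open>Mass and scaling of the kernel, behaviour of the semigroup down to time zero\<close>

text \<open>At time 1 the kernel is the product over the coordinates of normal densities with
  variance 2.\<close>

lemma heat_kernel_mass_1: "(\<integral>\<^sup>+z. ennreal (heat_kernel 1 (z :: real ^ 'n)) \<partial>lborel) = 1"
proof -
  have eq: "heat_kernel 1 z = (\<Prod>b\<in>Basis. normal_density 0 (sqrt 2) (z \<bullet> b))" for z :: "real ^ 'n"
  proof -
    have "(norm z)\<^sup>2 = (\<Sum>b\<in>Basis. (z \<bullet> b)\<^sup>2)"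
      unfolding power2_norm_eq_inner by (subst euclidean_inner) (simp add: power2_eq_square)
    then have "exp (- (norm z)\<^sup>2 / 4) = (\<Prod>b\<in>Basis. exp (- (z \<bullet> b)\<^sup>2 / 4))"
      by (subst exp_sum[symmetric]) (auto simp: sum_negf sum_divide_distrib)
    moreover have "(4 * pi) powr (- (real CARD('n) / 2)) = (1 / sqrt (4 * pi)) ^ CARD('n)"
    proof -
      have "(1 / sqrt (4 * pi)) ^ CARD('n) = ((4 * pi) powr (- (1 / 2))) powr real CARD('n)"
        by (subst powr_realpow) (simp_all add: powr_minus powr_half_sqrt inverse_eq_divide)
      then show ?thesis by (simp only: powr_powr) simp
    qed
    ultimately show ?thesis
      by (simp add: heat_kernel_def normal_density_def prod_dividef power_divide)
  qed
  have 1: "(\<integral>\<^sup>+s. ennreal (normal_density 0 (sqrt 2) s) \<partial>lborel) = 1"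
    by (subst nn_integral_eq_integral) (auto intro: integrable_normal_density integral_normal_density)
  have "(\<integral>\<^sup>+z. ennreal (heat_kernel 1 (z :: real ^ 'n)) \<partial>lborel) =
      (\<integral>\<^sup>+z. (\<Prod>b\<in>Basis. ennreal (normal_density 0 (sqrt 2) ((z :: real ^ 'n) \<bullet> b))) \<partial>lborel)"
    unfolding eq by (simp add: prod_ennreal)
  also have "\<dots> = 1"
    by (subst nn_integral_lborel_prod) (auto simp: 1)
  finally show ?thesis .
qed

lemma heat_kernel_scale:
  fixes z :: "real ^ 'n"
  assumes "t > 0"
  shows "sqrt t ^ CARD('n) * heat_kernel t (sqrt t *\<^sub>R z) = heat_kernel 1 z"
proof -
  have "sqrt t ^ CARD('n) = t powr (real CARD('n) / 2)"
    using assms by (simp add: powr_half_sqrt[symmetric] powr_realpow[symmetric] powr_powr)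
  moreover have "(4 * pi * t) powr (- (real CARD('n) / 2)) =
      (4 * pi) powr (- (real CARD('n) / 2)) * t powr (- (real CARD('n) / 2))"
    using assms by (simp add: powr_mult)
  ultimately show ?thesis
    using assms by (simp add: heat_kernel_def power_mult_distrib powr_minus field_simps)
qed

text \<open>The substitution y = x - sqrt t z with its Jacobian; it turns the kernel at time t into
  the kernel at time 1.\<close>

lemma lborel_heat_affine:
  fixes x :: "real ^ 'n"
  assumes "t > 0"
  shows "lborel = density (distr lborel borel (\<lambda>z. x + (- sqrt t) *\<^sub>R z)) (\<lambda>_. ennreal (sqrt t ^ CARD('n)))"
  using lborel_affine[of "- sqrt t" x] assms by simp

lemma nn_integral_heat_affine:
  fixes x :: "real ^ 'n"
  assumes t: "t > 0" and [measurable]: "f \<in> borel_measurable borel"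
  shows "(\<integral>\<^sup>+y. ennreal (heat_kernel t (x - y)) * f y \<partial>lborel) =
    (\<integral>\<^sup>+z. ennreal (heat_kernel 1 z) * f (x - sqrt t *\<^sub>R z) \<partial>lborel)"
proof -
  have "(\<integral>\<^sup>+y. ennreal (heat_kernel t (x - y)) * f y \<partial>lborel) =
      (\<integral>\<^sup>+z. ennreal (sqrt t ^ CARD('n)) * (ennreal (heat_kernel t (sqrt t *\<^sub>R z)) * f (x - sqrt t *\<^sub>R z)) \<partial>lborel)"
    by (subst lborel_heat_affine[OF t, of x]) (simp add: nn_integral_density nn_integral_distr)
  also have "\<dots> = (\<integral>\<^sup>+z. ennreal (heat_kernel 1 z) * f (x - sqrt t *\<^sub>R z) \<partial>lborel)"
    using t by (simp add: heat_kernel_scale[symmetric] ennreal_mult heat_kernel_nonneg mult.assoc)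
  finally show ?thesis .
qed

lemma heat_kernel_mass:
  fixes x :: "real ^ 'n"
  assumes "t > 0"
  shows "(\<integral>\<^sup>+y. ennreal (heat_kernel t (x - y)) \<partial>lborel) = 1"
  using nn_integral_heat_affine[OF assms, of "\<lambda>_. 1" x] by (simp add: heat_kernel_mass_1)

text \<open>After scaling, time enters only through the argument of \<eta>, and the formula also
  covers t = 0 because the kernel has mass one. Continuity of the semigroup at time zero becomes a
  dominated limit.\<close>

lemma heat_semigroup_scaled:
  fixes \<eta> :: "real ^ 'n \<Rightarrow> real"
  assumes t: "t \<ge> 0" and [measurable]: "\<eta> \<in> borel_measurable borel"
  shows "heat_semigroup t \<eta> x = (LINT z|lborel. heat_kernel 1 z * \<eta> (x - sqrt t *\<^sub>R z))"
proof (cases "t = 0")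
  case True
  have "(LINT z|lborel. heat_kernel 1 (z :: real ^ 'n)) = 1"
    by (subst integral_eq_nn_integral) (auto simp: heat_kernel_nonneg heat_kernel_mass_1)
  then show ?thesis by (simp add: True heat_semigroup_def)
next
  case False
  then have t: "t > 0" using t by simp
  have "(LINT y|lborel. heat_kernel t (x - y) * \<eta> y) =
      (LINT z|lborel. sqrt t ^ CARD('n) * (heat_kernel t (sqrt t *\<^sub>R z) * \<eta> (x - sqrt t *\<^sub>R z)))"
    by (subst lborel_heat_affine[OF t, of x]) (use t in \<open>simp add: integral_density integral_distr\<close>)
  then show ?thesis
    using t by (simp add: heat_semigroup_def heat_kernel_scale[symmetric] mult.assoc)
qed

lemma integrable_heat_kernel_1: "integrable lborel (heat_kernel 1 :: real ^ 'n \<Rightarrow> real)"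
  by (rule integrableI_nonneg) (auto simp: heat_kernel_nonneg heat_kernel_mass_1)

lemma heat_semigroup_continuous:
  fixes \<eta> :: "real ^ 'n \<Rightarrow> real"
  assumes \<eta>: "continuous_on UNIV \<eta>" and bd: "\<And>x. \<bar>\<eta> x\<bar> \<le> B"
  shows "continuous_on {0..} (\<lambda>t. heat_semigroup t \<eta> x)"
proof -
  have m [measurable]: "\<eta> \<in> borel_measurable borel"
    by (rule borel_measurable_continuous_onI[OF \<eta>])
  have "continuous_on {0..} (\<lambda>t. LINT z|lborel. heat_kernel 1 z * \<eta> (x - sqrt t *\<^sub>R z))"
    unfolding continuous_on_sequentially comp_def
  proof (intro allI ballI impI, elim conjE)
    fix s :: "nat \<Rightarrow> real" and t assume s: "s \<longlonglongrightarrow> t"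
    show "(\<lambda>n. LINT z|lborel. heat_kernel 1 z * \<eta> (x - sqrt (s n) *\<^sub>R z)) \<longlonglongrightarrow>
        (LINT z|lborel. heat_kernel 1 z * \<eta> (x - sqrt t *\<^sub>R z))"
    proof (rule integral_dominated_convergence[where w = "\<lambda>z. heat_kernel 1 z * B"])
      show "integrable lborel (\<lambda>z :: real ^ 'n. heat_kernel 1 z * B)"
        by (intro integrable_mult_left integrable_heat_kernel_1)
      show "AE z in lborel. (\<lambda>n. heat_kernel 1 z * \<eta> (x - sqrt (s n) *\<^sub>R z)) \<longlonglongrightarrow>
          heat_kernel 1 z * \<eta> (x - sqrt t *\<^sub>R z)"
        using \<eta> by (intro AE_I2 tendsto_intros s isCont_tendsto_compose[where g = \<eta>])
          (auto simp: continuous_on_eq_continuous_at)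
    qed (auto simp: abs_mult heat_kernel_nonneg bd intro!: mult_left_mono)
  qed
  then show ?thesis
    by (subst continuous_on_cong[OF refl heat_semigroup_scaled[OF _ m]]) auto
qed

lemma compact_support_bounded:
  fixes \<eta> :: "'a::topological_space \<Rightarrow> real"
  assumes \<eta>: "continuous_on UNIV \<eta>" and K: "compact K" "\<And>x. x \<notin> K \<Longrightarrow> \<eta> x = 0"
  obtains B where "B \<ge> 0" "\<And>x. \<bar>\<eta> x\<bar> \<le> B"
proof -
  have "bounded (\<eta> ` K)"
    using K by (intro compact_imp_bounded compact_continuous_image continuous_on_subset[OF \<eta>]) auto
  then obtain B where B: "\<And>x. x \<in> K \<Longrightarrow> \<bar>\<eta> x\<bar> \<le> B" by (auto simp: bounded_iff)
  have "\<bar>\<eta> x\<bar> \<le> max B 0" for x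
    using B[of x] K(2)[of x] by (cases "x \<in> K") auto
  then show ?thesis using that[of "max B 0"] by simp
qed

text \<open>Differentiability is known only for positive times; continuity up to 0 suffices for the
  fundamental theorem with exceptional endpoints.\<close>

lemma heat_semigroup_FTC:
  fixes \<psi> :: "real ^ 'n \<Rightarrow> real"
  assumes \<psi>: "has_laplacian \<psi> L" and K: "compact K" "\<And>x. x \<notin> K \<Longrightarrow> \<psi> x = 0" and t: "t \<ge> 0"
  shows "(LINT s:{0<..<t}|lborel. heat_semigroup s L x) = heat_semigroup t \<psi> x - \<psi> x"
proof -
  note cont = has_laplacian_continuous[OF \<psi>]
  have L0: "L x = 0" if "x \<notin> K" for x
    by (rule has_laplacian_support[OF \<psi> compact_imp_closed[OF K(1)] K(2) that])
  obtain B where B: "\<And>x. \<bar>\<psi> x\<bar> \<le> B"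
    using compact_support_bounded[OF cont(1) K] by metis
  obtain C where C: "\<And>x. \<bar>L x\<bar> \<le> C"
    using compact_support_bounded[OF cont(2) K(1) L0] by metis
  have "((\<lambda>s. heat_semigroup s L x) has_integral (heat_semigroup t \<psi> x - heat_semigroup 0 \<psi> x)) {0..t}"
  proof (rule fundamental_theorem_of_calculus_interior)
    show "continuous_on {0..t} (\<lambda>s. heat_semigroup s \<psi> x)"
      by (rule continuous_on_subset[OF heat_semigroup_continuous[OF cont(1) B]]) auto
    show "((\<lambda>s. heat_semigroup s \<psi> x) has_vector_derivative heat_semigroup s L x) (at s)"
      if "s \<in> {0<..<t}" for s
      using heat_semigroup_DERIV[OF \<psi> K, of s x] that
      by (simp add: has_real_derivative_iff_has_vector_derivative)
  qed (rule t)
  moreover have "set_integrable lborel {0<..<t} (\<lambda>s. heat_semigroup s L x)"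
    by (rule set_integrable_subset[OF borel_integrable_atLeastAtMost'[of 0 t]])
      (auto intro: continuous_on_subset[OF heat_semigroup_continuous[OF cont(2) C]])
  ultimately show ?thesis
    by (simp add: set_borel_integral_eq_integral has_integral_Icc_iff_Ioo integral_unique heat_semigroup_def)
qed

section \<open>Weak form of heat potentials\<close>

lemma heat_semigroup_measurable [measurable (raw)]:
  fixes x :: "'a \<Rightarrow> real ^ 'n"
  assumes [measurable]: "s \<in> borel_measurable M" "\<phi> \<in> borel_measurable borel" "x \<in> borel_measurable M"
  shows "(\<lambda>a. heat_semigroup (s a) \<phi> (x a)) \<in> borel_measurable M"
  unfolding heat_semigroup_def by measurable

lemma set_integral_shift:
  fixes F :: "real \<Rightarrow> real"
  shows "(LINT s:{c<..<t}|lborel. F (s - c)) = (LINT r:{0<..<t - c}|lborel. F r)"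
proof -
  have "(LINT s|lborel. indicator {c<..<t} s *\<^sub>R F (s - c)) =
      (LINT r|lborel. indicator {c<..<t} (c + 1 * r) *\<^sub>R F (c + 1 * r - c))"
    by (subst lborel_integral_real_affine[of 1 _ c]) simp_all
  also have "\<dots> = (LINT r|lborel. indicator {0<..<t - c} r *\<^sub>R F r)"
    by (intro Bochner_Integration.integral_cong) (auto simp: indicator_def)
  finally show ?thesis by (simp add: set_lebesgue_integral_def)
qed

text \<open>A superposition of heat kernels, each released at time \<open>\<tau> a\<close> from the
  point \<open>y a\<close> with strength \<open>g a\<close>. Duhamel integrals (M is space-time) and
  the evolution of the initial datum (M is space, \<tau> = 0) are both instances, so Fubini is
  carried out once. \<open>\<tau>_nonneg\<close> concerns only sources with nonzero strength, which
  lets \<open>g\<close> be cut off in time.\<close>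

locale heat_potential = sigma_finite_measure M for M :: "'a measure" +
  fixes \<tau> :: "'a \<Rightarrow> real" and y :: "'a \<Rightarrow> real ^ 'n" and g :: "'a \<Rightarrow> real" and t B :: real
  assumes \<tau>_measurable [measurable]: "\<tau> \<in> borel_measurable M"
    and y_measurable [measurable]: "y \<in> borel_measurable M"
    and g_measurable [measurable]: "g \<in> borel_measurable M"
    and t_pos: "t > 0"
    and \<tau>_nonneg: "\<And>a. g a \<noteq> 0 \<Longrightarrow> \<tau> a \<ge> 0"
    and bound: "\<And>s x. 0 < s \<Longrightarrow> s \<le> t \<Longrightarrow>
      (\<integral>\<^sup>+a. ennreal (if \<tau> a < s then heat_kernel (s - \<tau> a) (x - y a) * \<bar>g a\<bar> else 0) \<partial>M) \<le> ennreal B"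
begin

definition potential :: "real \<Rightarrow> real ^ 'n \<Rightarrow> real" where
  "potential s x = (LINT a|M. (if \<tau> a < s then heat_kernel (s - \<tau> a) (x - y a) * g a else 0))"

lemma nn_integral_kernel:
  assumes s: "0 < s" "s \<le> t"
  shows "(\<integral>\<^sup>+a. ennreal \<bar>if \<tau> a < s then heat_kernel (s - \<tau> a) (x - y a) * g a else 0\<bar> \<partial>M) \<le> ennreal B"
proof -
  have "(\<integral>\<^sup>+a. ennreal \<bar>if \<tau> a < s then heat_kernel (s - \<tau> a) (x - y a) * g a else 0\<bar> \<partial>M) =
      (\<integral>\<^sup>+a. ennreal (if \<tau> a < s then heat_kernel (s - \<tau> a) (x - y a) * \<bar>g a\<bar> else 0) \<partial>M)"
    by (intro nn_integral_cong) (auto simp: abs_mult heat_kernel_nonneg)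
  then show ?thesis using bound[OF s] by simp
qed

lemma integrable_kernel:
  assumes s: "0 < s" "s \<le> t"
  shows "integrable M (\<lambda>a. if \<tau> a < s then heat_kernel (s - \<tau> a) (x - y a) * g a else 0)"
  using nn_integral_kernel[OF s, of x] by (intro integrableI_bounded) (auto intro: le_less_trans)

text \<open>\<open>B\<close> carries no sign, and \<open>ennreal B\<close> is 0 for negative
  \<open>B\<close>; hence the maximum.\<close>

lemma potential_bounded:
  assumes s: "0 < s" "s \<le> t"
  shows "\<bar>potential s x\<bar> \<le> max B 0"
proof -
  have "ennreal \<bar>potential s x\<bar> \<le> ennreal B"
    using order_trans[OF integral_norm_bound_ennreal[OF integrable_kernel[OF s, of x]]] nn_integral_kernel[OF s, of x]
    by (simp add: potential_def)
  also have "\<dots> \<le> ennreal (max B 0)" by (intro ennreal_leI) simp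
  finally show ?thesis by (subst (asm) ennreal_le_iff) auto
qed

lemma integrable_potential:
  assumes s: "0 < s" "s \<le> t" and \<eta>: "integrable lborel \<eta>"
  shows "integrable lborel (\<lambda>x. potential s x * \<eta> x)"
proof -
  have [measurable]: "potential s \<in> borel_measurable lborel"
    unfolding potential_def by measurable
  have bd: "norm (potential s x * \<eta> x) \<le> norm (max B 0 * \<bar>\<eta> x\<bar>)" for x
    using potential_bounded[OF s, of x] by (auto simp: abs_mult intro!: mult_right_mono)
  have "integrable lborel (\<lambda>x. max B 0 * \<bar>\<eta> x\<bar>)" using \<eta> by auto
  then show ?thesis
    by (rule Bochner_Integration.integrable_bound) (use \<eta> bd in auto)
qed

text \<open>Fubini and the evenness of the kernel move the evolution from the sources onto \<eta>.
  Absolute convergence comes from \<open>bound\<close>, integrated against |\<eta>|. The third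
  estimate does not depend on \<open>s\<close>, which makes it integrable over (0,t) later.\<close>

lemma potential_duality:
  assumes s: "0 < s" "s \<le> t" and \<eta>: "integrable lborel \<eta>"
  shows "integrable M (\<lambda>a. if \<tau> a < s then g a * heat_semigroup (s - \<tau> a) \<eta> (y a) else 0)"
    and "(LINT x|lborel. potential s x * \<eta> x) =
      (LINT a|M. (if \<tau> a < s then g a * heat_semigroup (s - \<tau> a) \<eta> (y a) else 0))"
    and "(\<integral>\<^sup>+a. ennreal \<bar>if \<tau> a < s then g a * heat_semigroup (s - \<tau> a) \<eta> (y a) else 0\<bar> \<partial>M)
      \<le> ennreal B * (\<integral>\<^sup>+x. ennreal \<bar>\<eta> x\<bar> \<partial>lborel)"
proof -
  interpret P: pair_sigma_finite lborel M by unfold_locales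
  have [measurable]: "\<eta> \<in> borel_measurable borel" using \<eta> by auto
  define k where "k x a = (if \<tau> a < s then heat_kernel (s - \<tau> a) (x - y a) * g a else 0)" for x a
  have [measurable]: "(\<lambda>(x, a). k x a) \<in> borel_measurable (lborel \<Otimes>\<^sub>M M)"
    unfolding k_def by measurable
  have kbound: "(\<integral>\<^sup>+a. ennreal \<bar>k x a\<bar> \<partial>M) \<le> ennreal B" for x
    unfolding k_def by (rule nn_integral_kernel[OF s])
  have total: "(\<integral>\<^sup>+x. \<integral>\<^sup>+a. ennreal \<bar>k x a * \<eta> x\<bar> \<partial>M \<partial>lborel) \<le> ennreal B * (\<integral>\<^sup>+x. ennreal \<bar>\<eta> x\<bar> \<partial>lborel)"
  proof -
    have "(\<integral>\<^sup>+x. \<integral>\<^sup>+a. ennreal \<bar>k x a * \<eta> x\<bar> \<partial>M \<partial>lborel) =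
        (\<integral>\<^sup>+x. (\<integral>\<^sup>+a. ennreal \<bar>k x a\<bar> \<partial>M) * ennreal \<bar>\<eta> x\<bar> \<partial>lborel)"
      by (intro nn_integral_cong) (simp add: abs_mult ennreal_mult nn_integral_multc)
    also have "\<dots> \<le> (\<integral>\<^sup>+x. ennreal B * ennreal \<bar>\<eta> x\<bar> \<partial>lborel)"
      by (intro nn_integral_mono mult_right_mono kbound) auto
    also have "\<dots> = ennreal B * (\<integral>\<^sup>+x. ennreal \<bar>\<eta> x\<bar> \<partial>lborel)"
      by (simp add: nn_integral_cmult)
    finally show ?thesis .
  qed
  have fin: "ennreal B * (\<integral>\<^sup>+x. ennreal \<bar>\<eta> x\<bar> \<partial>lborel) < \<infinity>"
    using \<eta> by (auto simp: integrable_iff_bounded ennreal_mult_less_top)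
  have int: "integrable (lborel \<Otimes>\<^sub>M M) (\<lambda>(x, a). k x a * \<eta> x)"
  proof (rule integrableI_bounded)
    show "(\<integral>\<^sup>+p. ennreal (norm (case p of (x, a) \<Rightarrow> k x a * \<eta> x)) \<partial>(lborel \<Otimes>\<^sub>M M)) < \<infinity>"
      using total fin by (subst nn_integral_fst[symmetric]) (auto simp: case_prod_beta elim: le_less_trans)
  qed measurable
  have inner: "(LINT x|lborel. k x a * \<eta> x) =
      (if \<tau> a < s then g a * heat_semigroup (s - \<tau> a) \<eta> (y a) else 0)" for a
    by (auto simp: k_def heat_semigroup_def heat_kernel_commute[of _ "y a"] mult_ac
        simp flip: Bochner_Integration.integral_mult_right_zero intro!: Bochner_Integration.integral_cong)
  show "integrable M (\<lambda>a. if \<tau> a < s then g a * heat_semigroup (s - \<tau> a) \<eta> (y a) else 0)"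
    using P.integrable_snd[OF int] by (simp add: inner)
  have "(LINT x|lborel. potential s x * \<eta> x) = (LINT x|lborel. LINT a|M. k x a * \<eta> x)"
    unfolding potential_def k_def[symmetric] by simp
  also have "\<dots> = (LINT a|M. LINT x|lborel. k x a * \<eta> x)"
    using P.Fubini_integral[OF int] by simp
  finally show "(LINT x|lborel. potential s x * \<eta> x) =
      (LINT a|M. (if \<tau> a < s then g a * heat_semigroup (s - \<tau> a) \<eta> (y a) else 0))"
    by (simp add: inner)
  have "(\<integral>\<^sup>+a. ennreal \<bar>LINT x|lborel. k x a * \<eta> x\<bar> \<partial>M) \<le> (\<integral>\<^sup>+a. \<integral>\<^sup>+x. ennreal \<bar>k x a * \<eta> x\<bar> \<partial>lborel \<partial>M)"
    using P.AE_integrable_snd[OF int] integral_norm_bound_ennreal[of lborel]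
    by (intro nn_integral_mono_AE) (auto simp: real_norm_def[symmetric] simp del: real_norm_def)
  also have "\<dots> = (\<integral>\<^sup>+x. \<integral>\<^sup>+a. ennreal \<bar>k x a * \<eta> x\<bar> \<partial>M \<partial>lborel)"
    by (rule P.Fubini') measurable
  finally show "(\<integral>\<^sup>+a. ennreal \<bar>if \<tau> a < s then g a * heat_semigroup (s - \<tau> a) \<eta> (y a) else 0\<bar> \<partial>M)
      \<le> ennreal B * (\<integral>\<^sup>+x. ennreal \<bar>\<eta> x\<bar> \<partial>lborel)"
    using total by (simp add: inner)
qed

text \<open>Duality with \<eta> = \<open>L\<close> is integrated over s in (0,t). After exchanging
  the integrals, the fundamental theorem for the semigroup evaluates the time integral for each
  source separately, and duality with \<eta> = \<psi> at time t recognises the result.\<close>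

lemma potential_weak_form:
  assumes \<psi>: "has_laplacian \<psi> L" and K: "compact K" "\<And>x. x \<notin> K \<Longrightarrow> \<psi> x = 0"
    and g\<psi>: "integrable M (\<lambda>a. if \<tau> a < t then g a * \<psi> (y a) else 0)"
  shows "set_integrable lborel {0<..<t} (\<lambda>s. LINT x|lborel. potential s x * L x)"
    and "(LINT x|lborel. potential t x * \<psi> x) =
      (LINT s:{0<..<t}|lborel. LINT x|lborel. potential s x * L x)
      + (LINT a|M. (if \<tau> a < t then g a * \<psi> (y a) else 0))"
proof -
  interpret P: pair_sigma_finite lborel M by unfold_locales
  note cont = has_laplacian_continuous[OF \<psi>]
  have L0: "L x = 0" if "x \<notin> K" for x
    by (rule has_laplacian_support[OF \<psi> compact_imp_closed[OF K(1)] K(2) that])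
  have i\<psi>: "integrable lborel \<psi>" by (rule integrable_compact_support[OF cont(1) K])
  have iL: "integrable lborel L" by (rule integrable_compact_support[OF cont(2) K(1) L0])
  then have [measurable]: "L \<in> borel_measurable borel" by auto
  define h where "h s a = indicator {0<..<t} s *\<^sub>R
      (if \<tau> a < s then g a * heat_semigroup (s - \<tau> a) L (y a) else 0)" for s a
  have [measurable]: "(\<lambda>(s, a). h s a) \<in> borel_measurable (lborel \<Otimes>\<^sub>M M)"
    unfolding h_def by measurable
  \<comment> \<open>A bound uniform in \<open>s\<close>: integrating over (0,t) only costs the
    factor \<open>t\<close>.\<close>
  define C where "C = ennreal B * (\<integral>\<^sup>+x. ennreal \<bar>L x\<bar> \<partial>lborel)"
  have C: "C < \<infinity>"
    using iL by (auto simp: C_def integrable_iff_bounded ennreal_mult_less_top)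
  have hb: "(\<integral>\<^sup>+a. ennreal \<bar>h s a\<bar> \<partial>M) \<le> C * indicator {0<..<t} s" for s
    using potential_duality(3)[OF _ _ iL, of s] by (auto simp: h_def C_def indicator_def)
  have "(\<integral>\<^sup>+s. \<integral>\<^sup>+a. ennreal \<bar>h s a\<bar> \<partial>M \<partial>lborel) \<le> (\<integral>\<^sup>+s. C * indicator {0<..<t} s \<partial>lborel)"
    by (intro nn_integral_mono hb)
  also have "\<dots> = C * ennreal t"
    using t_pos by (subst nn_integral_cmult_indicator) auto
  also have "\<dots> < \<infinity>" using C by (simp add: ennreal_mult_less_top)
  finally have fin: "(\<integral>\<^sup>+s. \<integral>\<^sup>+a. ennreal \<bar>h s a\<bar> \<partial>M \<partial>lborel) < \<infinity>" .
  have int: "integrable (lborel \<Otimes>\<^sub>M M) (\<lambda>(s, a). h s a)"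
  proof (rule integrableI_bounded)
    show "(\<integral>\<^sup>+p. ennreal (norm (case p of (s, a) \<Rightarrow> h s a)) \<partial>(lborel \<Otimes>\<^sub>M M)) < \<infinity>"
      using fin by (subst nn_integral_fst[symmetric]) (auto simp: case_prod_beta)
  qed measurable
  have left: "(LINT a|M. h s a) = indicator {0<..<t} s *\<^sub>R (LINT x|lborel. potential s x * L x)" for s
    using potential_duality(2)[OF _ _ iL, of s] by (auto simp: h_def indicator_def)
  show "set_integrable lborel {0<..<t} (\<lambda>s. LINT x|lborel. potential s x * L x)"
    unfolding set_integrable_def left[symmetric] using P.integrable_fst[OF int] .
  \<comment> \<open>A source acts only after its release, so the time integral runs over (\<tau> a,
    t), and shifting by \<open>\<tau> a\<close> gives the fundamental theorem. If \<tau> a < 0, the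
    strength is zero and both sides vanish.\<close>
  have right: "(LINT s|lborel. h s a) =
      (if \<tau> a < t then g a * heat_semigroup (t - \<tau> a) \<psi> (y a) else 0) - (if \<tau> a < t then g a * \<psi> (y a) else 0)" for a
  proof (cases "\<tau> a < t")
    case True
    have "(LINT s|lborel. h s a) = (LINT s:{\<tau> a<..<t}|lborel. g a * heat_semigroup (s - \<tau> a) L (y a))"
      unfolding set_lebesgue_integral_def h_def using \<tau>_nonneg[of a]
      by (intro Bochner_Integration.integral_cong) (auto simp: indicator_def)
    also have "\<dots> = g a * (LINT r:{0<..<t - \<tau> a}|lborel. heat_semigroup r L (y a))"
      by (simp add: set_integral_shift[where F = "\<lambda>r. heat_semigroup r L (y a)"])
    also have "\<dots> = g a * (heat_semigroup (t - \<tau> a) \<psi> (y a) - \<psi> (y a))"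
      using True by (simp add: heat_semigroup_FTC[OF \<psi> K])
    finally show ?thesis using True by (simp add: algebra_simps)
  next
    case False
    then have "h s a = 0" for s by (auto simp: h_def indicator_def)
    then show ?thesis using False by simp
  qed
  have "(LINT s:{0<..<t}|lborel. LINT x|lborel. potential s x * L x) = (LINT s|lborel. LINT a|M. h s a)"
    by (simp add: set_lebesgue_integral_def left)
  also have "\<dots> = (LINT a|M. LINT s|lborel. h s a)"
    using P.Fubini_integral[OF int] by simp
  also have "\<dots> = (LINT a|M. (if \<tau> a < t then g a * heat_semigroup (t - \<tau> a) \<psi> (y a) else 0)
      - (if \<tau> a < t then g a * \<psi> (y a) else 0))"
    by (intro Bochner_Integration.integral_cong refl right)
  also have "\<dots> = (LINT x|lborel. potential t x * \<psi> x) - (LINT a|M. (if \<tau> a < t then g a * \<psi> (y a) else 0))"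
    using potential_duality(1,2)[OF t_pos order_refl i\<psi>] g\<psi>
    by (subst Bochner_Integration.integral_diff) auto
  finally show "(LINT x|lborel. potential t x * \<psi> x) =
      (LINT s:{0<..<t}|lborel. LINT x|lborel. potential s x * L x)
      + (LINT a|M. (if \<tau> a < t then g a * \<psi> (y a) else 0))" by simp
qed

end

text \<open>The indicator of \<open>(0,t)\<close> is part of the density because \<^term>\<open>f\<close> is only controlled on that interval.\<close>

lemma duhamel_weak_form:
  fixes f :: "real \<Rightarrow> real ^ 'n \<Rightarrow> real"
  assumes t: "t > 0"
    and f [measurable]: "(\<lambda>p. indicator {0<..<t} (fst p) * f (fst p) (snd p)) \<in> borel_measurable (lborel \<Otimes>\<^sub>M lborel)"
    and bound: "\<And>s x. 0 < s \<Longrightarrow> s \<le> t \<Longrightarrow>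
      (\<integral>\<^sup>+\<tau>. \<integral>\<^sup>+y. ennreal (indicator {0<..<s} \<tau> * (heat_kernel (s - \<tau>) (x - y) * \<bar>f \<tau> y\<bar>)) \<partial>lborel \<partial>lborel) \<le> ennreal B"
    and \<psi>: "has_laplacian \<psi> L" and K: "compact K" "\<And>x. x \<notin> K \<Longrightarrow> \<psi> x = 0"
    and f\<psi>: "integrable (lborel \<Otimes>\<^sub>M lborel) (\<lambda>p. indicator {0<..<t} (fst p) * (f (fst p) (snd p) * \<psi> (snd p)))"
  shows "\<And>s x. 0 < s \<Longrightarrow> s \<le> t \<Longrightarrow> \<bar>duhamel f s x\<bar> \<le> max B 0"
    and "\<And>s \<eta>. 0 < s \<Longrightarrow> s \<le> t \<Longrightarrow> integrable lborel \<eta> \<Longrightarrow> integrable lborel (\<lambda>x. duhamel f s x * \<eta> x)"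
    and "set_integrable lborel {0<..<t} (\<lambda>s. LINT x|lborel. duhamel f s x * L x)"
    and "set_integrable lborel {0<..<t} (\<lambda>\<tau>. LINT y|lborel. f \<tau> y * \<psi> y)"
    and "(LINT x|lborel. duhamel f t x * \<psi> x) =
      (LINT s:{0<..<t}|lborel. LINT x|lborel. duhamel f s x * L x)
      + (LINT \<tau>:{0<..<t}|lborel. LINT y|lborel. f \<tau> y * \<psi> y)"
proof -
  define g where "g p = indicator {0<..<t} (fst p) * f (fst p) (snd p)" for p
  have [measurable]: "g \<in> borel_measurable (lborel \<Otimes>\<^sub>M lborel)" unfolding g_def by measurable
  have kern: "(if \<tau> < s then heat_kernel (s - \<tau>) (x - y) * g (\<tau>, y) else 0) =
      indicator {0<..<s} \<tau> * (heat_kernel (s - \<tau>) (x - y) * f \<tau> y)" if "s \<le> t" for s \<tau> x y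
    using that by (auto simp: g_def indicator_def)
  have kern': "(if \<tau> < s then heat_kernel (s - \<tau>) (x - y) * \<bar>g (\<tau>, y)\<bar> else 0) =
      indicator {0<..<s} \<tau> * (heat_kernel (s - \<tau>) (x - y) * \<bar>f \<tau> y\<bar>)" if "s \<le> t" for s \<tau> x y
    using that by (auto simp: g_def indicator_def)
  interpret H: heat_potential "lborel \<Otimes>\<^sub>M lborel" fst snd g t B
  proof
    show "(\<integral>\<^sup>+a. ennreal (if fst a < s then heat_kernel (s - fst a) (x - snd a) * \<bar>g a\<bar> else 0) \<partial>(lborel \<Otimes>\<^sub>M lborel))
        \<le> ennreal B" if s: "0 < s" "s \<le> t" for s x
    proof -
      have "(\<integral>\<^sup>+a. ennreal (if fst a < s then heat_kernel (s - fst a) (x - snd a) * \<bar>g a\<bar> else 0) \<partial>(lborel \<Otimes>\<^sub>M lborel)) =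
        (\<integral>\<^sup>+\<tau>. \<integral>\<^sup>+y. ennreal (if \<tau> < s then heat_kernel (s - \<tau>) (x - y) * \<bar>g (\<tau>, y)\<bar> else 0) \<partial>lborel \<partial>lborel)"
        by (subst lborel.nn_integral_fst[symmetric]) (auto cong: if_cong)
      then show ?thesis using bound[OF s, of x] kern'[OF s(2)] by simp
    qed
    show "0 \<le> fst p" if "g p \<noteq> 0" for p using that by (auto simp: g_def indicator_def split: if_splits)
  qed (use t in measurable)
  \<comment> \<open>The potential is an integral over space-time and \<open>duhamel\<close> an
    iterated one; Fubini applies because the kernel is absolutely integrable by
    \<open>bound\<close>.\<close>
  have pot: "H.potential s x = duhamel f s x" if s: "0 < s" "s \<le> t" for s x
  proof -
    have "H.potential s x = (LINT \<tau>|lborel. LINT y|lborel. (if \<tau> < s then heat_kernel (s - \<tau>) (x - y) * g (\<tau>, y) else 0))"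
      unfolding H.potential_def
      using lborel_pair.integral_fst'[OF H.integrable_kernel[OF s, of x]] by (simp cong: if_cong)
    also have "\<dots> = duhamel f s x"
      unfolding duhamel_def set_lebesgue_integral_def kern[OF s(2)]
      by (intro Bochner_Integration.integral_cong) (auto simp: heat_semigroup_def indicator_def)
    finally show ?thesis .
  qed
  have "(if fst p < t then g p * \<psi> (snd p) else 0) = indicator {0<..<t} (fst p) * (f (fst p) (snd p) * \<psi> (snd p))" for p
    by (auto simp: g_def indicator_def)
  then have g\<psi>: "integrable (lborel \<Otimes>\<^sub>M lborel) (\<lambda>p. if fst p < t then g p * \<psi> (snd p) else 0)"
    "(LINT p|(lborel \<Otimes>\<^sub>M lborel). (if fst p < t then g p * \<psi> (snd p) else 0)) =
      (LINT \<tau>:{0<..<t}|lborel. LINT y|lborel. f \<tau> y * \<psi> y)"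
    using f\<psi> lborel_pair.integral_fst'[OF f\<psi>] by (simp_all add: set_lebesgue_integral_def)
  show "\<bar>duhamel f s x\<bar> \<le> max B 0" if "0 < s" "s \<le> t" for s x
    using H.potential_bounded[OF that, of x] that by (simp add: pot)
  show "integrable lborel (\<lambda>x. duhamel f s x * \<eta> x)" if "0 < s" "s \<le> t" "integrable lborel \<eta>" for s \<eta>
    using H.integrable_potential[OF that] that by (simp add: pot)
  have cong: "indicator {0<..<t} s *\<^sub>R (LINT x|lborel. H.potential s x * L x) =
      indicator {0<..<t} s *\<^sub>R (LINT x|lborel. duhamel f s x * L x)" for s
    by (auto simp: indicator_def pot)
  note W = H.potential_weak_form[OF \<psi> K g\<psi>(1)]
  show "set_integrable lborel {0<..<t} (\<lambda>s. LINT x|lborel. duhamel f s x * L x)"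
    using W(1) unfolding set_integrable_def cong .
  show "(LINT x|lborel. duhamel f t x * \<psi> x) =
      (LINT s:{0<..<t}|lborel. LINT x|lborel. duhamel f s x * L x)
      + (LINT \<tau>:{0<..<t}|lborel. LINT y|lborel. f \<tau> y * \<psi> y)"
    using W(2) t unfolding set_lebesgue_integral_def cong g\<psi>(2) by (simp add: pot)
  show "set_integrable lborel {0<..<t} (\<lambda>\<tau>. LINT y|lborel. f \<tau> y * \<psi> y)"
    using lborel_pair.integrable_fst'[OF f\<psi>] by (simp add: set_integrable_def)
qed

text \<open>All sources sit at time 0, so the source term of the weak form is the pairing of the
  datum with \<psi>. The bound required by the locale is that of \<phi>, as the kernel has mass
  one.\<close>

lemma heat_semigroup_weak_form:
  fixes \<phi> :: "real ^ 'n \<Rightarrow> real"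
  assumes t: "t > 0" and \<phi> [measurable]: "\<phi> \<in> borel_measurable borel" and bd: "\<And>x. \<bar>\<phi> x\<bar> \<le> B"
    and \<psi>: "has_laplacian \<psi> L" and K: "compact K" "\<And>x. x \<notin> K \<Longrightarrow> \<psi> x = 0"
  shows "\<And>s x. 0 < s \<Longrightarrow> s \<le> t \<Longrightarrow> \<bar>heat_semigroup s \<phi> x\<bar> \<le> max B 0"
    and "\<And>s \<eta>. 0 < s \<Longrightarrow> s \<le> t \<Longrightarrow> integrable lborel \<eta> \<Longrightarrow> integrable lborel (\<lambda>x. heat_semigroup s \<phi> x * \<eta> x)"
    and "set_integrable lborel {0<..<t} (\<lambda>s. LINT x|lborel. heat_semigroup s \<phi> x * L x)"
    and "(LINT x|lborel. heat_semigroup t \<phi> x * \<psi> x) =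
      (LINT s:{0<..<t}|lborel. LINT x|lborel. heat_semigroup s \<phi> x * L x) + (LINT y|lborel. \<phi> y * \<psi> y)"
proof -
  interpret H: heat_potential lborel "\<lambda>_. 0" "\<lambda>y. y" \<phi> t B
  proof
    show "(\<integral>\<^sup>+a. ennreal (if 0 < s then heat_kernel (s - 0) (x - a) * \<bar>\<phi> a\<bar> else 0) \<partial>lborel) \<le> ennreal B"
      if s: "0 < s" "s \<le> t" for s x
    proof -
      have "(\<integral>\<^sup>+a. ennreal (if 0 < s then heat_kernel (s - 0) (x - a) * \<bar>\<phi> a\<bar> else 0) \<partial>lborel) \<le>
          (\<integral>\<^sup>+a. ennreal (heat_kernel s (x - a)) * ennreal B \<partial>lborel)"
        using s bd
        by (intro nn_integral_mono) (auto simp: ennreal_mult'[symmetric] heat_kernel_nonneg intro!: ennreal_leI mult_left_mono)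
      also have "\<dots> = ennreal B"
        using s by (simp add: nn_integral_multc heat_kernel_mass)
      finally show ?thesis .
    qed
  qed (use t in auto)
  have pot: "H.potential s x = heat_semigroup s \<phi> x" if "0 < s" for s x
    using that by (simp add: H.potential_def heat_semigroup_def)
  have i\<psi>: "integrable lborel \<psi>"
    by (rule integrable_compact_support[OF has_laplacian_continuous(1)[OF \<psi>] K])
  then have [measurable]: "\<psi> \<in> borel_measurable borel" by auto
  have iB: "integrable lborel (\<lambda>x. B * \<bar>\<psi> x\<bar>)" using i\<psi> by auto
  have ae: "AE x in lborel. norm (\<phi> x * \<psi> x) \<le> norm (B * \<bar>\<psi> x\<bar>)"
  proof (rule AE_I2)
    fix x show "norm (\<phi> x * \<psi> x) \<le> norm (B * \<bar>\<psi> x\<bar>)"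
      using mult_right_mono[OF order_trans[OF bd[of x] abs_ge_self[of B]] abs_ge_zero[of "\<psi> x"]]
      by (simp add: abs_mult)
  qed
  have "integrable lborel (\<lambda>x. \<phi> x * \<psi> x)"
    by (rule Bochner_Integration.integrable_bound[OF iB _ ae]) measurable
  then have \<phi>\<psi>: "integrable lborel (\<lambda>y. if 0 < t then \<phi> y * \<psi> y else 0)" using t by simp
  note W = H.potential_weak_form[OF \<psi> K \<phi>\<psi>]
  show "\<bar>heat_semigroup s \<phi> x\<bar> \<le> max B 0" if "0 < s" "s \<le> t" for s x
    using H.potential_bounded[OF that, of x] that by (simp add: pot)
  show "integrable lborel (\<lambda>x. heat_semigroup s \<phi> x * \<eta> x)" if "0 < s" "s \<le> t" "integrable lborel \<eta>" for s \<eta>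
    using H.integrable_potential[OF that] that by (simp add: pot)
  have cong: "indicator {0<..<t} s *\<^sub>R (LINT x|lborel. H.potential s x * L x) =
      indicator {0<..<t} s *\<^sub>R (LINT x|lborel. heat_semigroup s \<phi> x * L x)" for s
    by (auto simp: indicator_def pot)
  show "set_integrable lborel {0<..<t} (\<lambda>s. LINT x|lborel. heat_semigroup s \<phi> x * L x)"
    using W(1) unfolding set_integrable_def cong .
  show "(LINT x|lborel. heat_semigroup t \<phi> x * \<psi> x) =
      (LINT s:{0<..<t}|lborel. LINT x|lborel. heat_semigroup s \<phi> x * L x) + (LINT y|lborel. \<phi> y * \<psi> y)"
    using W(2) t unfolding set_lebesgue_integral_def cong by (simp add: pot)
qed

section \<open>Test functions and the energy inequality\<close>

text \<open>The summand 1 forces linear growth, so F becomes positive; from then on F^(1-p)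
  decreases at rate at least (p-1) c and would be negative after finite time.\<close>

lemma superlinear_growth_blowup:
  fixes F :: "real \<Rightarrow> real"
  assumes p: "p > 1" and c: "c > 0"
    and F: "\<And>t. t \<ge> t0 \<Longrightarrow> (F has_real_derivative F' t) (at t)"
    and F': "\<And>t. t \<ge> t0 \<Longrightarrow> F' t \<ge> c * \<bar>F t\<bar> powr p + 1"
  shows False
proof -
  have lin: "F t0 - t0 \<le> F t - t" if "t0 \<le> t" for t
  proof (rule DERIV_nonneg_imp_nondecreasing[OF that])
    fix x assume x: "t0 \<le> x"
    have "0 \<le> c * \<bar>F x\<bar> powr p" using c by simp
    then have "((\<lambda>t. F t - t) has_real_derivative F' x - 1) (at x)" "F' x - 1 \<ge> 0"
      using F'[OF x] F[OF x] by (auto intro!: derivative_eq_intros)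
    then show "\<exists>y. ((\<lambda>t. F t - t) has_real_derivative y) (at x) \<and> 0 \<le> y" by blast
  qed
  \<comment> \<open>From here on F t \<ge> F t0 + |F t0| + 1 > 0.\<close>
  define t1 where "t1 = t0 + \<bar>F t0\<bar> + 1"
  have t1: "t0 \<le> t1" by (simp add: t1_def)
  have pos: "F t > 0" if "t1 \<le> t" for t
    using lin[of t] that t1 unfolding t1_def by linarith
  define G where "G t = - (F t powr (1 - p)) - (p - 1) * c * t" for t
  have mono: "G t1 \<le> G t" if "t1 \<le> t" for t
  proof (rule DERIV_nonneg_imp_nondecreasing[OF that])
    fix x assume x: "t1 \<le> x"
    then have x0: "t0 \<le> x" using t1 by simp
    have "((\<lambda>t. F t powr (1 - p)) has_real_derivative (1 - p) * F x powr (1 - p - 1) * F' x) (at x)"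
      by (rule DERIV_chain2[OF has_real_derivative_powr F[OF x0]]) (rule pos[OF x])
    then have "(G has_real_derivative (p - 1) * (F x powr (- p) * F' x - c)) (at x)"
      unfolding G_def by (rule DERIV_cong[OF DERIV_diff[OF DERIV_minus DERIV_cmult_Id]]) (simp add: algebra_simps)
    moreover have "c \<le> F x powr (- p) * F' x"
    proof -
      have "c = F x powr (- p) * (c * F x powr p)"
        using pos[OF x] by (simp add: powr_minus)
      also have "\<dots> \<le> F x powr (- p) * F' x"
        using F'[OF x0] pos[OF x] by (intro mult_left_mono) auto
      finally show ?thesis .
    qed
    ultimately show "\<exists>y. (G has_real_derivative y) (at x) \<and> 0 \<le> y"
      using p by (intro exI conjI mult_nonneg_nonneg) auto
  qed
  \<comment> \<open>The time at which F^(1-p) is used up at the guaranteed rate; the extra 1 makes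
    the bound strictly negative.\<close>
  define t2 where "t2 = t1 + F t1 powr (1 - p) / ((p - 1) * c) + 1"
  have pc: "(p - 1) * c > 0" using p c by simp
  have "t1 \<le> t2" using pc by (simp add: t2_def)
  then have "F t2 powr (1 - p) \<le> F t1 powr (1 - p) - (p - 1) * c * (t2 - t1)"
    using mono[of t2] by (simp add: G_def algebra_simps)
  also have "(p - 1) * c * (t2 - t1) = F t1 powr (1 - p) + (p - 1) * c"
    using p c unfolding t2_def by (simp add: field_simps)
  finally have "F t2 powr (1 - p) \<le> - ((p - 1) * c)" by simp
  then show False using pc by (smt (verit) powr_ge_zero)
qed

section \<open>Cutoff functions supported away from the origin\<close>

text \<open>At 0 the difference quotient is at most |h|^(m+1), so exponents of at least 2 smooth out
  the kink of the positive part.\<close>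

lemma DERIV_pos_part_power:
  "((\<lambda>s::real. max 0 s ^ (m + 2)) has_real_derivative real (m + 2) * max 0 s ^ (m + 1)) (at s)"
proof -
  consider "s < 0" | "s = 0" | "s > 0" by linarith
  then show ?thesis
  proof cases
    case 1
    have "((\<lambda>_::real. 0::real) has_real_derivative 0) (at s)" by simp
    then have "((\<lambda>s::real. max 0 s ^ (m + 2)) has_real_derivative 0) (at s)"
      by (rule has_field_derivative_transform_within_open[of _ _ _ "{..<0}"]) (use 1 in auto)
    then show ?thesis using 1 by simp
  next
    case 2
    have "((\<lambda>h::real. max 0 h ^ (m + 2) / h) \<longlongrightarrow> 0) (at 0)"
    proof (rule Lim_null_comparison)
      have "norm (max 0 h ^ (m + 2) / h) \<le> \<bar>h\<bar> ^ (m + 1)" for h :: real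
      proof (cases "h > 0")
        case False
        then have "norm (max 0 h ^ (m + 2) / h) = 0" by simp
        also have "\<dots> \<le> \<bar>h\<bar> ^ (m + 1)" by (rule zero_le_power) simp
        finally show ?thesis .
      qed simp
      then show "\<forall>\<^sub>F h::real in at 0. norm (max 0 h ^ (m + 2) / h) \<le> \<bar>h\<bar> ^ (m + 1)"
        by simp
      show "((\<lambda>h::real. \<bar>h\<bar> ^ (m + 1)) \<longlongrightarrow> 0) (at 0)"
        by (rule tendsto_eq_rhs[OF tendsto_power[OF tendsto_rabs[OF tendsto_ident_at]]]) simp
    qed
    then show ?thesis using 2 by (simp add: DERIV_def)
  next
    case 3
    have "((\<lambda>s::real. s ^ (m + 2)) has_real_derivative real (m + 2) * s ^ (m + 1)) (at s)"
      using DERIV_pow[of "m + 2" s] by simp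
    then have "((\<lambda>s::real. max 0 s ^ (m + 2)) has_real_derivative real (m + 2) * s ^ (m + 1)) (at s)"
      by (rule has_field_derivative_transform_within_open[of _ _ _ "{0<..}"]) (use 3 in auto)
    then show ?thesis using 3 by simp
  qed
qed

text \<open>The support avoids the origin because the cutoff profile is \<open>-1\<close> there; the exponent
  \<open>m + 3\<close> of the positive part is large enough for \<open>\<bar>\<Delta>\<psi>\<bar> \<le> C \<psi>\<^sup>1\<^sup>/\<^sup>p\<close>.\<close>

lemma cutoff_profile:
  fixes n p :: real
  assumes n: "n > 0" and p: "p > 1" and m: "real (m + 3) / p \<le> real (m + 1)"
  defines "q r \<equiv> 1 - 2 * exp (- n * r) - r / n"
  defines "\<psi> x \<equiv> max 0 (q ((norm (x :: real ^ 'n))\<^sup>2)) ^ (m + 3)"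
  shows "\<exists>L K C. has_laplacian \<psi> L \<and> compact K \<and> 0 \<notin> K \<and> (\<forall>x. x \<notin> K \<longrightarrow> \<psi> x = 0) \<and>
     (\<forall>x. \<bar>L x\<bar> \<le> C * \<psi> x powr (1 / p))"
proof -
  define q' where "q' r = 2 * n * exp (- n * r) - 1 / n" for r
  define q'' where "q'' r = - 2 * n\<^sup>2 * exp (- n * r)" for r
  define M where "M r = max 0 (q r)" for r
  define P where "P r = M r ^ (m + 3)" for r
  define P' where "P' r = real (m + 3) * M r ^ (m + 2) * q' r" for r
  define P'' where "P'' r = real (m + 3) * (real (m + 2) * M r ^ (m + 1) * q' r * q' r + M r ^ (m + 2) * q'' r)" for r
  have dq: "(q has_real_derivative q' r) (at r)" for r
    unfolding q_def q'_def using n by (auto intro!: derivative_eq_intros)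
  have dq': "(q' has_real_derivative q'' r) (at r)" for r
    unfolding q'_def q''_def by (auto intro!: derivative_eq_intros simp: power2_eq_square)
  have dM: "((\<lambda>r. M r ^ (k + 2)) has_real_derivative real (k + 2) * M r ^ (k + 1) * q' r) (at r)" for k r
    unfolding M_def by (rule DERIV_chain2[OF DERIV_pos_part_power dq])
  have dP: "(P has_real_derivative P' r) (at r)" for r
    using dM[of "m + 1" r] unfolding P_def P'_def by (simp add: numeral_3_eq_3)
  have dP': "(P' has_real_derivative P'' r) (at r)" for r
    unfolding P'_def mult.assoc
    by (rule DERIV_cong[OF DERIV_cmult[OF DERIV_mult[OF dM dq']]]) (simp add: P''_def algebra_simps)
  have cq: "continuous_on A q" "continuous_on A q'" "continuous_on A q''" for A
    unfolding q_def q'_def q''_def using n by (auto intro!: continuous_intros)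
  have cM: "continuous_on A M" for A unfolding M_def by (intro continuous_intros cq)
  define L :: "real ^ 'n \<Rightarrow> real" where
    "L x = 4 * (norm x)\<^sup>2 * P'' ((norm x)\<^sup>2) + 2 * real CARD('n) * P' ((norm x)\<^sup>2)" for x
  have "continuous_on {0..} P''"
    unfolding P''_def by (intro continuous_intros cq cM)
  from has_laplacian_radial[of P P' P'' "0 :: real ^ 'n", OF dP dP' this]
  have L: "has_laplacian \<psi> L"
    by (simp add: \<psi>_def[abs_def] L_def[abs_def] P_def M_def)
  define K where "K = {x :: real ^ 'n. 0 \<le> q ((norm x)\<^sup>2)}"
  \<comment> \<open>The term r / n exceeds 1 beyond r = n, which confines the support to the ball of
    radius sqrt n.\<close>
  have r_le: "r \<le> n" if "0 \<le> q r" for r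
  proof -
    have "0 \<le> exp (- n * r)" by simp
    then have "r / n \<le> 1" using that unfolding q_def by linarith
    then show ?thesis using n by (simp add: field_simps)
  qed
  have "norm x \<le> sqrt n" if "x \<in> K" for x
    using r_le that by (simp add: K_def real_le_rsqrt)
  then have "bounded K" by (auto simp: bounded_iff)
  moreover have "closed K"
    unfolding K_def by (intro closed_Collect_le continuous_intros continuous_on_compose2[OF cq(1)]) auto
  ultimately have K: "compact K" by (simp add: compact_eq_bounded_closed)
  have K0: "0 \<notin> K" by (simp add: K_def q_def)
  have off: "\<psi> x = 0" if "x \<notin> K" for x
    using that by (auto simp: K_def \<psi>_def max_def)
  \<comment> \<open>What is left of the bound for |L x| at |x|^2 = r once s^(m+1) is factored out, s
    being the positive part of the profile. It is continuous on [0,n], hence bounded by a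
    constant.\<close>
  define A where "A r = 4 * r * (real (m + 3) * (real (m + 2) * \<bar>q' r\<bar> * \<bar>q' r\<bar> + \<bar>q'' r\<bar>))
      + 2 * real CARD('n) * (real (m + 3) * \<bar>q' r\<bar>)" for r
  have "bounded (A ` {0..n})"
    unfolding A_def by (intro compact_imp_bounded compact_continuous_image continuous_intros cq) auto
  then obtain C where "\<forall>z\<in>A ` {0..n}. norm z \<le> C" unfolding bounded_iff by blast
  then have C: "\<bar>A r\<bar> \<le> C" if "0 \<le> r" "r \<le> n" for r
    using that by simp
  have C0: "C \<ge> 0" using C[of 0] n by linarith
  have "\<bar>L x\<bar> \<le> C * \<psi> x powr (1 / p)" for x
  proof (cases "M ((norm x)\<^sup>2) = 0")
    case True
    then show ?thesis using C0 by (simp add: L_def P'_def P''_def)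
  next
    case False
    define r where "r = (norm x)\<^sup>2"
    have r0: "r \<ge> 0" by (simp add: r_def)
    define s where "s = M r"
    have s: "s > 0" using False by (simp add: s_def M_def r_def)
    then have rn: "r \<le> n" using r_le[of r] by (simp add: s_def M_def max_def split: if_splits)
    have s1: "s \<le> 1"
    proof -
      have "0 \<le> exp (- n * r)" "0 \<le> r / n" using r0 n by auto
      then have "q r \<le> 1" unfolding q_def by linarith
      then show ?thesis by (simp add: s_def M_def)
    qed
    have pw: "s ^ (m + 2) \<le> s ^ (m + 1)"
      using s s1 by (intro power_decreasing) auto
    have P'b: "\<bar>P' r\<bar> \<le> s ^ (m + 1) * (real (m + 3) * \<bar>q' r\<bar>)"
    proof -
      have "\<bar>P' r\<bar> = s ^ (m + 2) * (real (m + 3) * \<bar>q' r\<bar>)"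
        using s by (simp add: P'_def s_def[symmetric] abs_mult)
      also have "\<dots> \<le> s ^ (m + 1) * (real (m + 3) * \<bar>q' r\<bar>)"
        by (intro mult_right_mono pw) auto
      finally show ?thesis .
    qed
    have P''b: "\<bar>P'' r\<bar> \<le> s ^ (m + 1) * (real (m + 3) * (real (m + 2) * \<bar>q' r\<bar> * \<bar>q' r\<bar> + \<bar>q'' r\<bar>))"
    proof -
      have "\<bar>P'' r\<bar> \<le> real (m + 3) * (\<bar>real (m + 2) * s ^ (m + 1) * q' r * q' r\<bar> + \<bar>s ^ (m + 2) * q'' r\<bar>)"
        unfolding P''_def s_def[symmetric] abs_mult[of "real (m + 3)"] by (intro mult_mono abs_triangle_ineq) auto
      also have "\<dots> = real (m + 3) * (s ^ (m + 1) * (real (m + 2) * \<bar>q' r\<bar> * \<bar>q' r\<bar>) + s ^ (m + 2) * \<bar>q'' r\<bar>)"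
        using s by (simp add: abs_mult)
      also have "\<dots> \<le> real (m + 3) * (s ^ (m + 1) * (real (m + 2) * \<bar>q' r\<bar> * \<bar>q' r\<bar>) + s ^ (m + 1) * \<bar>q'' r\<bar>)"
        by (intro mult_left_mono add_left_mono mult_right_mono pw) auto
      finally show ?thesis by (simp only: distrib_left mult_ac)
    qed
    have "\<bar>L x\<bar> \<le> 4 * r * \<bar>P'' r\<bar> + 2 * real CARD('n) * \<bar>P' r\<bar>"
      unfolding L_def r_def[symmetric] using r0
      by (intro order_trans[OF abs_triangle_ineq]) (simp add: abs_mult)
    also have "\<dots> \<le> 4 * r * (s ^ (m + 1) * (real (m + 3) * (real (m + 2) * \<bar>q' r\<bar> * \<bar>q' r\<bar> + \<bar>q'' r\<bar>)))
        + 2 * real CARD('n) * (s ^ (m + 1) * (real (m + 3) * \<bar>q' r\<bar>))"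
      using r0 by (intro add_mono mult_left_mono P'b P''b) auto
    also have "\<dots> = s ^ (m + 1) * A r"
      unfolding A_def by (simp only: distrib_left mult_ac)
    also have "\<dots> \<le> s ^ (m + 1) * C"
      using C[OF r0 rn] s by (intro mult_left_mono) auto
    \<comment> \<open>For 0 < s \<le> 1 a smaller exponent gives a larger power, and hypothesis
      \<open>m\<close> says (m+3)/p \<le> m+1. As \<psi> x = s^(m+3), the power on the right is
      \<psi>^(1/p).\<close>
    also have "\<dots> \<le> s powr (real (m + 3) / p) * C"
    proof (intro mult_right_mono C0)
      have "s ^ (m + 1) = s powr real (m + 1)" using powr_realpow[OF s, of "m + 1"] by simp
      also have "\<dots> \<le> s powr (real (m + 3) / p)" using s s1 m by (intro powr_mono') auto
      finally show "s ^ (m + 1) \<le> s powr (real (m + 3) / p)" .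
    qed
    also have "s powr (real (m + 3) / p) = \<psi> x powr (1 / p)"
    proof -
      have "\<psi> x = s powr real (m + 3)"
        using powr_realpow[OF s, of "m + 3"] by (simp add: \<psi>_def s_def M_def r_def)
      then show ?thesis by (simp only: powr_powr) simp
    qed
    finally show ?thesis by (simp add: mult.commute)
  qed
  then show ?thesis using L K K0 off by blast
qed

text \<open>The cutoffs lie in [0,1] and tend to 1 off the origin, so the integrals of w \<psi>_j
  tend to the positive integral of w, with |w| as majorant; one sufficiently late cutoff
  serves.\<close>

lemma exists_test_function:
  fixes w :: "real ^ 'n \<Rightarrow> real" and p :: real
  assumes p: "p > 1" and w: "integrable lborel w" and pos: "(LINT x|lborel. w x) > 0"
  obtains \<psi> L :: "real ^ 'n \<Rightarrow> real" and K C
  where "has_laplacian \<psi> L" "compact K" "0 \<notin> K" "\<And>x. x \<notin> K \<Longrightarrow> \<psi> x = 0" "\<And>x. \<psi> x \<ge> 0"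
    "\<And>x. \<bar>L x\<bar> \<le> C * \<psi> x powr (1 / p)" "(LINT x|lborel. w x * \<psi> x) > 0"
proof -
  \<comment> \<open>The inequality m + 3 \<le> (m + 1) p solved for m; this is where p > 1
    enters.\<close>
  obtain m :: nat where m: "(3 - p) / (p - 1) \<le> real m" using real_arch_simple by blast
  have "real (m + 3) \<le> real (m + 1) * p"
    using m p by (simp add: field_simps)
  then have m: "real (m + 3) / p \<le> real (m + 1)"
    using p by (simp add: pos_divide_le_eq)
  define \<psi> :: "nat \<Rightarrow> real ^ 'n \<Rightarrow> real" where
    "\<psi> j x = max 0 (1 - 2 * exp (- real (Suc j) * (norm x)\<^sup>2) - (norm x)\<^sup>2 / real (Suc j)) ^ (m + 3)" for j x
  have b: "0 \<le> \<psi> j x" "\<psi> j x \<le> 1" for j x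
  proof -
    have "1 - 2 * exp (- real (Suc j) * (norm x)\<^sup>2) - (norm x)\<^sup>2 / real (Suc j) \<le> 1"
    proof -
      have "0 \<le> exp (- real (Suc j) * (norm x)\<^sup>2)" "0 \<le> (norm x)\<^sup>2 / real (Suc j)" by auto
      then show ?thesis by linarith
    qed
    then show "0 \<le> \<psi> j x" "\<psi> j x \<le> 1" unfolding \<psi>_def by (auto intro!: power_le_one)
  qed
  have "(\<lambda>j. LINT x|lborel. w x * \<psi> j x) \<longlonglongrightarrow> (LINT x|lborel. w x)"
  proof (rule integral_dominated_convergence[where w = "\<lambda>x. \<bar>w x\<bar>"])
    show "w \<in> borel_measurable lborel" using w by auto
    then show "(\<lambda>x. w x * \<psi> j x) \<in> borel_measurable lborel" for j
      unfolding \<psi>_def by measurable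
    \<comment> \<open>Every cutoff is 0 at the origin, so convergence to 1 fails there, on a null
      set.\<close>
    show "AE x in lborel. (\<lambda>j. w x * \<psi> j x) \<longlonglongrightarrow> w x"
      using AE_lborel_singleton[of 0]
    proof eventually_elim
      fix x :: "real ^ 'n" assume "x \<noteq> 0"
      then have r: "(norm x)\<^sup>2 > 0" by simp
      have "(\<lambda>j. 1 - 2 * exp (- real (Suc j) * (norm x)\<^sup>2) - (norm x)\<^sup>2 / real (Suc j)) \<longlonglongrightarrow> 1"
        using r by real_asymp
      then have "(\<lambda>j. w x * \<psi> j x) \<longlonglongrightarrow> w x * max 0 1 ^ (m + 3)"
        unfolding \<psi>_def by (intro tendsto_intros)
      then show "(\<lambda>j. w x * \<psi> j x) \<longlonglongrightarrow> w x" by simp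
    qed
    show "AE x in lborel. norm (w x * \<psi> j x) \<le> \<bar>w x\<bar>" for j
      using b by (auto simp: abs_mult intro!: mult_left_le)
  qed (use w in auto)
  from order_tendstoD(1)[OF this pos] obtain j where j: "(LINT x|lborel. w x * \<psi> j x) > 0"
    by (auto simp: eventually_sequentially)
  obtain L K C where "has_laplacian (\<psi> j) L" "compact K" "0 \<notin> K" "\<And>x. x \<notin> K \<Longrightarrow> \<psi> j x = 0"
    "\<And>x. \<bar>L x\<bar> \<le> C * \<psi> j x powr (1 / p)"
    using cutoff_profile[of "real (Suc j)" p m, where ?'n = 'n] p m unfolding \<psi>_def by auto
  then show ?thesis using that j b by blast
qed

section \<open>Convexity inequalities and the lower bound for the energy derivative\<close>

text \<open>The left side is the tangent to s^p at A, that is, A^p + p A^(p-1) (s - A). Integrated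
  with A a weighted mean, it yields Jensen's inequality.\<close>

lemma powr_tangent_le:
  fixes s A p :: real
  assumes "p > 1" "s \<ge> 0" "A \<ge> 0"
  shows "p * A powr (p - 1) * s - (p - 1) * A powr p \<le> s powr p"
proof -
  define q where "q = p / (p - 1)"
  have q: "q > 1" "1 / p + 1 / q = 1" "(p - 1) * q = p" "p / q = p - 1"
    using assms by (auto simp: q_def field_simps)
  have "s * A powr (p - 1) \<le> s powr p / p + (A powr (p - 1)) powr q / q"
    by (rule Youngs_inequality) (use assms q in auto)
  also have "(A powr (p - 1)) powr q = A powr p" by (simp add: powr_powr q)
  finally have "p * (s * A powr (p - 1)) \<le> p * (s powr p / p + A powr p / q)"
    using assms by (intro mult_left_mono) auto
  also have "\<dots> = s powr p + p / q * A powr p" using assms by (simp add: distrib_left)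
  finally show ?thesis using q by (simp add: mult_ac)
qed

text \<open>The threshold (C/a)^(1/(p-1)) is where C v and a v^p cross (for C > 0): above it the
  power dominates, below it C v is at most its value at the threshold.\<close>

lemma powr_absorbs_linear:
  fixes a C v p :: real
  assumes "p > 1" "a > 0" "C \<ge> 0" "v \<ge> 0"
  shows "C * v \<le> a * v powr p + C * (C / a) powr (1 / (p - 1))"
proof (cases "v \<le> (C / a) powr (1 / (p - 1))")
  case True
  then have "C * v \<le> C * (C / a) powr (1 / (p - 1))" using assms by (intro mult_left_mono) auto
  then show ?thesis using assms by (smt (verit) mult_nonneg_nonneg powr_ge_zero)
next
  case False
  then have v: "v > 0" by (smt (verit) powr_ge_zero)
  have "C / a = ((C / a) powr (1 / (p - 1))) powr (p - 1)"
    using assms by (simp add: powr_powr)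
  also have "\<dots> \<le> v powr (p - 1)"
    using False assms by (intro powr_mono2) auto
  finally have "C \<le> a * v powr (p - 1)" using assms by (simp add: field_simps)
  then have "C * v \<le> a * v powr (p - 1) * v" using v by (intro mult_right_mono) auto
  also have "\<dots> = a * v powr p" using v by (simp add: powr_diff)
  finally show ?thesis using assms by (smt (verit) mult_nonneg_nonneg powr_ge_zero)
qed

text \<open>Two open sets cover the space because 0 is not in \<open>K\<close>: off the origin the
  weight is continuous, off \<open>K\<close> the product is zero.\<close>

lemma continuous_on_weight:
  fixes u :: "real ^ 'n \<Rightarrow> real"
  assumes u: "continuous_on UNIV u" and \<psi>: "continuous_on UNIV \<psi>"
    and K: "closed K" "0 \<notin> K" "\<And>x. x \<notin> K \<Longrightarrow> \<psi> x = 0" and p: "p > 0"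
  shows "continuous_on UNIV (\<lambda>x. norm x powr \<alpha> * \<bar>u x\<bar> powr p * \<psi> x)"
proof -
  note [continuous_intros] = continuous_on_compose2[OF u] continuous_on_compose2[OF \<psi>]
  have "continuous_on (- {0} \<union> - K) (\<lambda>x. norm x powr \<alpha> * \<bar>u x\<bar> powr p * \<psi> x)"
  proof (rule continuous_on_open_Un)
    show "continuous_on (- {0}) (\<lambda>x. norm x powr \<alpha> * \<bar>u x\<bar> powr p * \<psi> x)"
      using p by (intro continuous_intros continuous_on_powr') auto
    show "continuous_on (- K) (\<lambda>x. norm x powr \<alpha> * \<bar>u x\<bar> powr p * \<psi> x)"
      by (rule continuous_on_eq[OF continuous_on_const[of _ 0]]) (auto simp: K(3))
  qed (use K(1) in auto)
  also have "- {0} \<union> - K = UNIV" using K(2) by auto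
  finally show ?thesis .
qed

text \<open>One half of the lower bound \<open>a\<close> of the weight on \<open>K\<close> absorbs u
  \<Delta>\<psi>; the other half, by Jensen's inequality for the measure \<psi> dx of mass S, gives
  the power of the energy. The loss \<open>D\<close> is a constant times the measure of
  \<open>K\<close>, the same for all u.\<close>

lemma energy_lower_bound:
  fixes \<psi> L :: "real ^ 'n \<Rightarrow> real"
  assumes p: "p > 1" and \<psi>: "has_laplacian \<psi> L" and K: "compact K" "0 \<notin> K" "\<And>x. x \<notin> K \<Longrightarrow> \<psi> x = 0"
    and nonneg: "\<And>x. \<psi> x \<ge> 0" and LC: "\<And>x. \<bar>L x\<bar> \<le> C * \<psi> x powr (1 / p)"
    and mass: "(LINT x|lborel. \<psi> x) > 0"
  obtains c D where "c > 0" "\<And>u. continuous_on UNIV u \<Longrightarrow>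
    c * \<bar>LINT x|lborel. u x * \<psi> x\<bar> powr p - D \<le>
    (LINT x|lborel. u x * L x + norm x powr \<alpha> * \<bar>u x\<bar> powr p * \<psi> x)"
proof -
  note cont = has_laplacian_continuous[OF \<psi>]
  have L0: "L x = 0" if "x \<notin> K" for x
    by (rule has_laplacian_support[OF \<psi> compact_imp_closed[OF K(1)] K(3) that])
  note int = integrable_compact_support[OF _ K(1)]
  have "\<exists>a>0. \<forall>x\<in>K. a \<le> norm x powr \<alpha>"
  proof (cases "K = {}")
    case False
    have "continuous_on K (\<lambda>x. norm x powr \<alpha>)"
      using K(2) by (intro continuous_intros) auto
    from continuous_attains_inf[OF K(1) False this] obtain x0 where
      "x0 \<in> K" "\<forall>x\<in>K. norm x0 powr \<alpha> \<le> norm x powr \<alpha>" by blast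
    then show ?thesis using K(2) by (intro exI[of _ "norm x0 powr \<alpha>"]) auto
  qed (auto intro: exI[of _ 1])
  then obtain a where a: "a > 0" "\<And>x. x \<in> K \<Longrightarrow> a \<le> norm x powr \<alpha>" by blast
  define C' where "C' = max C 0"
  have LC': "\<bar>L x\<bar> \<le> C' * \<psi> x powr (1 / p)" for x
    using LC[of x] by (rule order_trans) (simp add: C'_def mult_right_mono)
  \<comment> \<open>The constant of \<open>powr_absorbs_linear\<close> for linear coefficient C' and
    power coefficient a/2.\<close>
  define E where "E = C' * (C' / (a / 2)) powr (1 / (p - 1))"
  define D where "D = E * measure lborel K"
  define S where "S = (LINT x|lborel. \<psi> x)"
  have fin: "emeasure lborel K < \<infinity>" using emeasure_compact_finite[OF K(1)] by simp
  have Km [measurable]: "K \<in> sets borel" using K(1) by (simp add: borel_compact)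
  show ?thesis
  proof (rule that)
    show "a / 2 * S powr (1 - p) > 0" using a mass by (simp add: S_def)
    fix u :: "real ^ 'n \<Rightarrow> real" assume u: "continuous_on UNIV u"
    note [continuous_intros] = cont[THEN continuous_on_compose2] continuous_on_compose2[OF u]
    have iL: "integrable lborel (\<lambda>x. u x * L x)"
      by (intro int continuous_intros) (auto simp: L0)
    have iP: "integrable lborel (\<lambda>x. norm x powr \<alpha> * \<bar>u x\<bar> powr p * \<psi> x)"
      using p by (intro int continuous_on_weight[OF u cont(1) compact_imp_closed[OF K(1)] K(2)]) (auto simp: K(3))
    have iU: "integrable lborel (\<lambda>x. \<bar>u x\<bar> powr p * \<psi> x)"
      using p by (intro int continuous_intros continuous_on_powr') (auto simp: K(3))
    have iu: "integrable lborel (\<lambda>x. u x * \<psi> x)" "integrable lborel (\<lambda>x. \<bar>u x\<bar> * \<psi> x)" "integrable lborel \<psi>"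
      by (intro int continuous_intros; auto simp: K(3))+
    define U where "U = (LINT x|lborel. \<bar>u x\<bar> powr p * \<psi> x)"
    define F where "F = \<bar>LINT x|lborel. u x * \<psi> x\<bar>"
    have F0: "F \<ge> 0" by (simp add: F_def)
    have "F \<le> (LINT x|lborel. \<bar>u x * \<psi> x\<bar>)"
      unfolding F_def by (rule integral_abs_bound)
    then have F: "F \<le> (LINT x|lborel. \<bar>u x\<bar> * \<psi> x)" by (simp add: abs_mult nonneg)
    have jensen: "S powr (1 - p) * F powr p \<le> U"
    proof -
      \<comment> \<open>F/S is the optimal tangent point: there the tangent bound becomes A^p S =
        S^(1-p) F^p.\<close>
      define A where "A = F / S"
      have A: "A \<ge> 0" "F = A * S" using F0 mass by (auto simp: A_def S_def)
      have "A powr p * S = p * A powr (p - 1) * F - (p - 1) * A powr p * S"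
        using A by (cases "A = 0") (simp_all add: powr_diff algebra_simps)
      also have "\<dots> \<le> p * A powr (p - 1) * (LINT x|lborel. \<bar>u x\<bar> * \<psi> x) - (p - 1) * A powr p * S"
        using F p by (intro diff_right_mono mult_left_mono) auto
      also have "\<dots> = (LINT x|lborel. p * A powr (p - 1) * (\<bar>u x\<bar> * \<psi> x) - (p - 1) * A powr p * \<psi> x)"
        using iu by (simp add: S_def)
      also have "\<dots> \<le> U"
        unfolding U_def
      proof (rule integral_mono)
        show "p * A powr (p - 1) * (\<bar>u x\<bar> * \<psi> x) - (p - 1) * A powr p * \<psi> x \<le> \<bar>u x\<bar> powr p * \<psi> x" for x
          using mult_right_mono[OF powr_tangent_le[OF p abs_ge_zero A(1), of "u x"] nonneg[of x]]
          by (simp add: algebra_simps)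
      qed (use iu iU in auto)
      also have "A powr p * S = S powr (1 - p) * F powr p"
        using mass F0 by (simp add: A_def S_def powr_divide powr_diff)
      finally show ?thesis .
    qed
    have "a / 2 * U - D = (LINT x|lborel. a / 2 * (\<bar>u x\<bar> powr p * \<psi> x) - E * indicator K x)"
      using iU fin by (simp add: U_def D_def)
    also have "\<dots> \<le> (LINT x|lborel. u x * L x + norm x powr \<alpha> * \<bar>u x\<bar> powr p * \<psi> x)"
    proof (rule integral_mono)
      show "integrable lborel (\<lambda>x. a / 2 * (\<bar>u x\<bar> powr p * \<psi> x) - E * indicator K x)"
        using iU fin by auto
      show "integrable lborel (\<lambda>x. u x * L x + norm x powr \<alpha> * \<bar>u x\<bar> powr p * \<psi> x)"
        using iL iP by auto
      fix x
      show "a / 2 * (\<bar>u x\<bar> powr p * \<psi> x) - E * indicator K x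
          \<le> u x * L x + norm x powr \<alpha> * \<bar>u x\<bar> powr p * \<psi> x"
      proof (cases "x \<in> K")
        case True
        \<comment> \<open>Chosen so that v^p = |u|^p \<psi> while |u L| \<le> C' v.\<close>
        define v where "v = \<bar>u x\<bar> * \<psi> x powr (1 / p)"
        have vp: "v powr p = \<bar>u x\<bar> powr p * \<psi> x"
          using p nonneg[of x] by (simp add: v_def powr_mult powr_powr)
        have "\<bar>u x * L x\<bar> \<le> C' * v"
          using mult_left_mono[OF LC'[of x] abs_ge_zero[of "u x"]] by (simp add: v_def abs_mult mult_ac)
        also have "\<dots> \<le> a / 2 * v powr p + E"
          unfolding E_def using a p nonneg by (intro powr_absorbs_linear) (auto simp: C'_def v_def)
        finally have "\<bar>u x * L x\<bar> \<le> a / 2 * (\<bar>u x\<bar> powr p * \<psi> x) + E" by (simp only: vp)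
        moreover have "a * (\<bar>u x\<bar> powr p * \<psi> x) \<le> norm x powr \<alpha> * (\<bar>u x\<bar> powr p * \<psi> x)"
          using a(2)[OF True] nonneg[of x] by (intro mult_right_mono) auto
        ultimately show ?thesis using True by (simp add: abs_le_iff mult.assoc)
      qed (simp add: K(3) L0)
    qed
    finally have "a / 2 * U - D \<le> (LINT x|lborel. u x * L x + norm x powr \<alpha> * \<bar>u x\<bar> powr p * \<psi> x)" .
    moreover have "a / 2 * (S powr (1 - p) * F powr p) \<le> a / 2 * U"
      using jensen a by (intro mult_left_mono) auto
    ultimately show "a / 2 * S powr (1 - p) * \<bar>LINT x|lborel. u x * \<psi> x\<bar> powr p - D \<le>
        (LINT x|lborel. u x * L x + norm x powr \<alpha> * \<bar>u x\<bar> powr p * \<psi> x)"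
      by (simp add: F_def mult.assoc)
  qed
qed

text \<open>The common end of both cases. Only times above 1 occur, where the forcing is
  t^m.\<close>

lemma no_global_energy:
  fixes \<psi> L w :: "real ^ 'n \<Rightarrow> real"
  assumes p: "p > 1" and m: "m > 0"
    and \<psi>: "has_laplacian \<psi> L" and K: "compact K" "0 \<notin> K" "\<And>x. x \<notin> K \<Longrightarrow> \<psi> x = 0"
    and nonneg: "\<And>x. \<psi> x \<ge> 0" and LC: "\<And>x. \<bar>L x\<bar> \<le> C * \<psi> x powr (1 / p)"
    and pos: "(LINT x|lborel. w x * \<psi> x) > 0"
    and u: "\<And>t. t > 1 \<Longrightarrow> continuous_on UNIV (u t)"
    and deriv: "\<And>t. t > 1 \<Longrightarrow> ((\<lambda>t. LINT x|lborel. u t x * \<psi> x) has_real_derivative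
      (LINT x|lborel. u t x * L x + norm x powr \<alpha> * \<bar>u t x\<bar> powr p * \<psi> x)
      + t powr m * (LINT x|lborel. w x * \<psi> x)) (at t)"
  shows False
proof -
  define I where "I = (LINT x|lborel. w x * \<psi> x)"
  \<comment> \<open>A nonnegative \<psi> with integral 0 vanishes almost everywhere and could not
    pair positively with w.\<close>
  have "(LINT x|lborel. \<psi> x) \<noteq> 0"
  proof
    assume "(LINT x|lborel. \<psi> x) = 0"
    moreover have "integrable lborel \<psi>"
      by (rule integrable_compact_support[OF has_laplacian_continuous(1)[OF \<psi>] K(1,3)])
    ultimately have "AE x in lborel. \<psi> x = 0"
      using nonneg by (subst (asm) integral_nonneg_eq_0_iff_AE) auto
    then have "I = 0"
      unfolding I_def by (intro integral_eq_zero_AE) auto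
    then show False using pos by (simp add: I_def)
  qed
  moreover have "(LINT x|lborel. \<psi> x) \<ge> 0" by (simp add: nonneg)
  ultimately have mass: "(LINT x|lborel. \<psi> x) > 0" by simp
  show False
  proof (rule energy_lower_bound[OF p \<psi> K nonneg LC mass, where \<alpha> = \<alpha>])
    fix c D assume c: "c > 0"
      and lower: "\<And>u. continuous_on UNIV u \<Longrightarrow> c * \<bar>LINT x|lborel. u x * \<psi> x\<bar> powr p - D \<le>
        (LINT x|lborel. u x * L x + norm x powr \<alpha> * \<bar>u x\<bar> powr p * \<psi> x)"
    \<comment> \<open>Beyond this time t^m I \<ge> |D| + 1, which pays for D and leaves 1; the 2
      keeps t above 1.\<close>
    define t0 where "t0 = max 2 (((\<bar>D\<bar> + 1) / I) powr (1 / m))"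
    show False
    proof (rule superlinear_growth_blowup[OF p c, of t0])
      fix t assume t: "t0 \<le> t"
      then have t1: "t > 1" by (simp add: t0_def)
      show "((\<lambda>t. LINT x|lborel. u t x * \<psi> x) has_real_derivative
        (LINT x|lborel. u t x * L x + norm x powr \<alpha> * \<bar>u t x\<bar> powr p * \<psi> x) + t powr m * I) (at t)"
        unfolding I_def by (rule deriv[OF t1])
      have "(\<bar>D\<bar> + 1) / I = (((\<bar>D\<bar> + 1) / I) powr (1 / m)) powr m"
        using m pos by (simp add: powr_powr I_def)
      also have "\<dots> \<le> t powr m"
        using t m by (intro powr_mono2) (auto simp: t0_def)
      finally have "\<bar>D\<bar> + 1 \<le> t powr m * I" using pos by (simp add: I_def field_simps)
      then show "c * \<bar>LINT x|lborel. u t x * \<psi> x\<bar> powr p + 1 \<le>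
        (LINT x|lborel. u t x * L x + norm x powr \<alpha> * \<bar>u t x\<bar> powr p * \<psi> x) + t powr m * I"
        using lower[OF u[OF t1]] by linarith
    qed
  qed
qed

section \<open>The energy of mild and classical solutions\<close>

lemma joint_imp_slice_continuous:
  assumes "continuous_on (S \<times> UNIV) (\<lambda>(t, x). f t x)" "t \<in> S"
  shows "continuous_on UNIV (f t)"
proof -
  have "continuous_on UNIV (\<lambda>x. (\<lambda>(t, x). f t x) (t, x))"
    by (rule continuous_on_compose2[OF assms(1)]) (use assms(2) in \<open>auto intro!: continuous_intros\<close>)
  then show ?thesis by simp
qed

lemma integral_continuous_on_compact_support:
  fixes f :: "real \<Rightarrow> 'a::euclidean_space \<Rightarrow> real"
  assumes f: "continuous_on (S \<times> UNIV) (\<lambda>(t, x). f t x)"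
    and K: "compact K" "\<And>t x. x \<notin> K \<Longrightarrow> f t x = 0"
  shows "continuous_on S (\<lambda>t. LINT x|lborel. f t x)"
proof -
  obtain a b where ab: "K \<subseteq> cbox a b"
    using bounded_subset_cbox_symmetric[OF compact_imp_bounded[OF K(1)]] by blast
  have "continuous_on S (\<lambda>t. integral (cbox a b) (f t))"
    by (rule integral_continuous_on_param[OF continuous_on_subset[OF f]]) auto
  moreover have "(LINT x|lborel. f t x) = integral (cbox a b) (f t)" if "t \<in> S" for t
    using integral_lborel_compact_support[OF joint_imp_slice_continuous[OF f that] K(1) ab] K(2) by simp
  ultimately show ?thesis by (simp cong: continuous_on_cong)
qed

lemma integral_DERIV_compact_support:
  fixes f :: "real \<Rightarrow> 'a::euclidean_space \<Rightarrow> real"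
  assumes S: "open S" "convex S" "t \<in> S"
    and f: "continuous_on (S \<times> UNIV) (\<lambda>(t, x). f t x)" and f': "continuous_on (S \<times> UNIV) (\<lambda>(t, x). f' t x)"
    and deriv: "\<And>t x. t \<in> S \<Longrightarrow> ((\<lambda>t. f t x) has_real_derivative f' t x) (at t)"
    and K: "compact K" "\<And>t x. x \<notin> K \<Longrightarrow> f t x = 0" "\<And>t x. x \<notin> K \<Longrightarrow> f' t x = 0"
  shows "((\<lambda>t. LINT x|lborel. f t x) has_real_derivative (LINT x|lborel. f' t x)) (at t)"
proof -
  obtain a b where ab: "K \<subseteq> cbox a b"
    using bounded_subset_cbox_symmetric[OF compact_imp_bounded[OF K(1)]] by blast
  have d: "((\<lambda>t. f t x) has_real_derivative f' s x) (at s within S)" if "s \<in> S" for s x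
    using deriv[OF that] by (rule has_field_derivative_at_within)
  have i: "f s integrable_on cbox a b" if "s \<in> S" for s
    by (rule integrable_continuous[OF continuous_on_subset[OF joint_imp_slice_continuous[OF f that]]]) auto
  have c: "continuous_on (S \<times> cbox a b) (\<lambda>(t, x). f' t x)"
    by (rule continuous_on_subset[OF f']) auto
  have "((\<lambda>t. integral (cbox a b) (f t)) has_field_derivative integral (cbox a b) (f' t)) (at t within S)"
    by (rule leibniz_rule_field_derivative[where fx = f', OF d i c S(3,2)])
  then have d: "((\<lambda>t. integral (cbox a b) (f t)) has_field_derivative integral (cbox a b) (f' t)) (at t)"
    by (simp only: at_within_open[OF S(3,1)])
  have eq: "integral (cbox a b) (f s) = (LINT x|lborel. f s x)" if "s \<in> S" for s
    using integral_lborel_compact_support[OF joint_imp_slice_continuous[OF f that] K(1) ab] K(2) by simp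
  have "((\<lambda>t. LINT x|lborel. f t x) has_real_derivative integral (cbox a b) (f' t)) (at t)"
    by (rule has_field_derivative_transform_within_open[OF d S(1,3) eq])
  moreover have "(LINT x|lborel. f' t x) = integral (cbox a b) (f' t)"
    using integral_lborel_compact_support[OF joint_imp_slice_continuous[OF f' S(3)] K(1) ab] K(3) by simp
  ultimately show ?thesis by simp
qed

lemma continuous_on_weight_1:
  fixes \<psi> :: "real ^ 'n \<Rightarrow> real"
  assumes \<psi>: "continuous_on UNIV \<psi>" and K: "closed K" "0 \<notin> K" "\<And>x. x \<notin> K \<Longrightarrow> \<psi> x = 0"
  shows "continuous_on UNIV (\<lambda>x. norm x powr \<alpha> * \<psi> x)"
  using continuous_on_weight[OF continuous_on_const[of _ 1] \<psi> K, of 1] by simp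

lemma continuous_on_energy_density:
  fixes \<psi> L :: "real ^ 'n \<Rightarrow> real"
  assumes u: "continuous_on (S \<times> UNIV) (\<lambda>(t, x). u t x)" and L: "continuous_on UNIV L"
    and \<psi>: "continuous_on UNIV \<psi>" and K: "closed K" "0 \<notin> K" "\<And>x. x \<notin> K \<Longrightarrow> \<psi> x = 0" and p: "p > 0"
  shows "continuous_on (S \<times> UNIV) (\<lambda>(t, x). u t x * L x + norm x powr \<alpha> * \<bar>u t x\<bar> powr p * \<psi> x)"
proof -
  have "continuous_on (S \<times> UNIV) (\<lambda>q. u (fst q) (snd q))" using u by (simp add: case_prod_beta)
  note [continuous_intros] = this continuous_on_compose2[OF L, of _ snd]
    continuous_on_compose2[OF continuous_on_weight_1[OF \<psi> K, of \<alpha>], of _ snd]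
  have "continuous_on (S \<times> UNIV) (\<lambda>q. u (fst q) (snd q) * L (snd q)
      + \<bar>u (fst q) (snd q)\<bar> powr p * (norm (snd q) powr \<alpha> * \<psi> (snd q)))"
    using p by (intro continuous_intros continuous_on_powr') auto
  then show ?thesis by (simp add: case_prod_beta mult_ac)
qed

lemma classical_solution_energy:
  fixes \<psi> L w :: "real ^ 'n \<Rightarrow> real"
  assumes cl: "classical_solution \<alpha> p z w u0 u" and p: "p > 0" and w: "continuous_on UNIV w"
    and \<psi>: "has_laplacian \<psi> L" and K: "compact K" "0 \<notin> K" "\<And>x. x \<notin> K \<Longrightarrow> \<psi> x = 0" and t: "t > 0"
  shows "continuous_on UNIV (u t)"
    and "((\<lambda>t. LINT x|lborel. u t x * \<psi> x) has_real_derivative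
      (LINT x|lborel. u t x * L x + norm x powr \<alpha> * \<bar>u t x\<bar> powr p * \<psi> x)
      + z t * (LINT x|lborel. w x * \<psi> x)) (at t)"
proof -
  note cont = has_laplacian_continuous[OF \<psi>]
  have u: "continuous_on ({0<..} \<times> UNIV) (\<lambda>(t, x). u t x)"
    using cl by (auto simp: classical_solution_def intro: continuous_on_subset)
  define ut where "ut t x = deriv (\<lambda>s. u s x) t" for t x
  have ut: "continuous_on ({0<..} \<times> UNIV) (\<lambda>(t, x). ut t x)"
    using cl by (auto simp: classical_solution_def ut_def)
  have dut: "((\<lambda>s. u s x) has_real_derivative ut t x) (at t)" if "t > 0" for t x
    using cl that unfolding classical_solution_def ut_def
    by (metis DERIV_deriv_iff_real_differentiable)
  show ucont: "continuous_on UNIV (u t)"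
    by (rule joint_imp_slice_continuous[OF u]) (use t in auto)
  have mult: "continuous_on ({0<..} \<times> UNIV) (\<lambda>(t, x). g t x * \<psi> x)"
    if "continuous_on ({0<..} \<times> UNIV) (\<lambda>(t, x). g t x)" for g :: "real \<Rightarrow> real ^ 'n \<Rightarrow> real"
    using continuous_on_mult[OF that continuous_on_compose2[OF cont(1) continuous_on_snd[OF continuous_on_id]]]
    by (simp add: case_prod_beta)
  have deriv: "((\<lambda>t. LINT x|lborel. u t x * \<psi> x) has_real_derivative (LINT x|lborel. ut t x * \<psi> x)) (at t)"
    by (rule integral_DERIV_compact_support[where S = "{0<..}" and K = K])
      (use t K mult[OF u] mult[OF ut] dut in \<open>auto intro!: DERIV_cmult_right\<close>)
  \<comment> \<open>The hypotheses on second partial derivatives are specialised to equal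
    indices.\<close>
  have lap: "has_laplacian (u t) (laplacian (u t))"
    unfolding has_laplacian_def
  proof (intro conjI exI allI)
    show "laplacian (u t) = (\<lambda>x. \<Sum>i\<in>UNIV. partial i (partial i (u t)) x)"
      by (auto simp: laplacian_def)
    show "twice_diff_along (axis i 1) (u t) (partial i (partial i (u t)))" for i
      unfolding twice_diff_along_def
    proof (intro conjI exI allI)
      show "continuous_on UNIV (partial i (partial i (u t)))"
        using cl t by (intro joint_imp_slice_continuous[where S = "{0<..}"]) (auto simp: classical_solution_def)
      have "has_partial i (u t) x" "has_partial i (partial i (u t)) x" for x
        using cl t by (auto simp: classical_solution_def)
      then show "((\<lambda>h. u t (x + h *\<^sub>R axis i 1)) has_real_derivative partial i (u t) x) (at 0)"
        "((\<lambda>h. partial i (u t) (x + h *\<^sub>R axis i 1)) has_real_derivative partial i (partial i (u t)) x) (at 0)" for x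
        unfolding has_partial_def partial_def[of i "u t" x] partial_def[of i "partial i (u t)" x]
        by (simp_all add: DERIV_deriv_iff_real_differentiable)
    qed
  qed (rule ucont)
  have L0: "L x = 0" if "x \<notin> K" for x
    by (rule has_laplacian_support[OF \<psi> compact_imp_closed[OF K(1)] K(3) that])
  note int = integrable_compact_support[OF _ K(1)]
  note [continuous_intros] = cont[THEN continuous_on_compose2] continuous_on_compose2[OF ucont]
    continuous_on_compose2[OF w] continuous_on_compose2[OF has_laplacian_continuous(2)[OF lap]]
  have i1: "integrable lborel (\<lambda>x. laplacian (u t) x * \<psi> x)"
    and i2: "integrable lborel (\<lambda>x. w x * \<psi> x)" and i3: "integrable lborel (\<lambda>x. u t x * L x)"
    by (intro int continuous_intros; auto simp: K(3) L0)+
  have i4: "integrable lborel (\<lambda>x. norm x powr \<alpha> * \<bar>u t x\<bar> powr p * \<psi> x)"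
    using p by (intro int continuous_on_weight[OF ucont cont(1) compact_imp_closed[OF K(1)] K(2)]) (auto simp: K(3))
  have eq: "ut t x = laplacian (u t) x + norm x powr \<alpha> * \<bar>u t x\<bar> powr p + z t * w x" for x
    using cl t by (simp add: classical_solution_def ut_def algebra_simps)
  have "(LINT x|lborel. ut t x * \<psi> x) =
      (LINT x|lborel. laplacian (u t) x * \<psi> x + norm x powr \<alpha> * \<bar>u t x\<bar> powr p * \<psi> x + z t * (w x * \<psi> x))"
    by (simp add: eq algebra_simps)
  also have "\<dots> = (LINT x|lborel. laplacian (u t) x * \<psi> x)
      + (LINT x|lborel. norm x powr \<alpha> * \<bar>u t x\<bar> powr p * \<psi> x) + z t * (LINT x|lborel. w x * \<psi> x)"
    using i1 i2 i4 by simp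
  also have "(LINT x|lborel. laplacian (u t) x * \<psi> x) = (LINT x|lborel. u t x * L x)"
    by (rule green_identity[OF lap \<psi> K(1,3)])
  also have "\<dots> + (LINT x|lborel. norm x powr \<alpha> * \<bar>u t x\<bar> powr p * \<psi> x) =
      (LINT x|lborel. u t x * L x + norm x powr \<alpha> * \<bar>u t x\<bar> powr p * \<psi> x)"
    using i3 i4 by simp
  finally show "((\<lambda>t. LINT x|lborel. u t x * \<psi> x) has_real_derivative
      (LINT x|lborel. u t x * L x + norm x powr \<alpha> * \<bar>u t x\<bar> powr p * \<psi> x)
      + z t * (LINT x|lborel. w x * \<psi> x)) (at t)"
    using deriv by simp
qed

section \<open>Bounds and integrability for the source terms of mild solutions\<close>

lemma C0_bounded:
  fixes w :: "real ^ 'n \<Rightarrow> real"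
  assumes "w \<in> C0"
  obtains W where "W \<ge> 0" "\<And>x. \<bar>w x\<bar> \<le> W"
proof -
  have w: "continuous_on UNIV w" "(w \<longlongrightarrow> 0) at_infinity" using assms by (auto simp: C0_def)
  have "eventually (\<lambda>x. dist (w x) 0 < 1) at_infinity"
    using w(2) by (rule tendstoD) simp
  then obtain b where b: "\<And>x. norm x \<ge> b \<Longrightarrow> \<bar>w x\<bar> < 1" by (auto simp: eventually_at_infinity)
  have "bounded (w ` cball 0 b)"
    by (intro compact_imp_bounded compact_continuous_image continuous_on_subset[OF w(1)]) auto
  then obtain c where c: "\<forall>z\<in>w ` cball 0 b. norm z \<le> c" unfolding bounded_iff by blast
  have "\<bar>w x\<bar> \<le> max c 1" for x
    using b[of x] c by (cases "norm x \<ge> b") (auto simp: le_max_iff_disj)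
  then show ?thesis using that[of "max c 1"] by simp
qed

lemma \<zeta>_nonneg: "\<zeta> \<sigma> m t \<ge> 0"
  by (simp add: \<zeta>_def)

lemma \<zeta>_measurable [measurable]: "\<zeta> \<sigma> m \<in> borel_measurable borel"
  unfolding \<zeta>_def by measurable

text \<open>x^\<sigma> + T^m dominates both branches on (0,T); \<sigma> > -1 makes the first summand
  integrable at 0.\<close>

lemma \<zeta>_integrable:
  assumes \<sigma>: "\<sigma> > -1" and m: "m > 0" and T: "T \<ge> 0"
  shows "set_integrable lborel {0<..<T} (\<zeta> \<sigma> m)"
proof -
  let ?f = "\<lambda>x. if x \<in> {0..T} then x powr \<sigma> else 0"
  have hi: "(?f has_integral (T powr (\<sigma> + 1) / (\<sigma> + 1))) UNIV"
    using has_integral_powr_from_0[OF \<sigma> T] by (subst has_integral_restrict_UNIV)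
  have "(\<integral>\<^sup>+x. ennreal (?f x) \<partial>lborel) = ennreal (T powr (\<sigma> + 1) / (\<sigma> + 1))"
    by (rule nn_integral_has_integral_lborel[OF _ _ hi]) auto
  then have "integrable lborel ?f"
    by (intro integrableI_nonneg) auto
  moreover have "integrable lborel (\<lambda>x. indicator {0..T} x *\<^sub>R (T powr m))"
    by (intro borel_integrable_compact) auto
  ultimately have int: "integrable lborel (\<lambda>x. ?f x + indicator {0..T} x *\<^sub>R (T powr m))"
    by (rule Bochner_Integration.integrable_add)
  have bd: "norm (indicator {0<..<T} x *\<^sub>R \<zeta> \<sigma> m x) \<le> norm (?f x + indicator {0..T} x *\<^sub>R (T powr m))" for x
  proof (cases "x \<in> {0<..<T}")
    case True
    then have "x powr m \<le> T powr m" using m by (intro powr_mono2) auto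
    then have "\<zeta> \<sigma> m x \<le> x powr \<sigma> + T powr m"
      using powr_ge_zero[of x \<sigma>] powr_ge_zero[of T m]
      unfolding \<zeta>_def by (cases "x < 1"; simp only: if_True if_False; linarith)
    then show ?thesis using True \<zeta>_nonneg[of \<sigma> m x] by simp
  qed simp
  show ?thesis
    unfolding set_integrable_def
    by (rule Bochner_Integration.integrable_bound[OF int _ AE_I2[OF bd]]) measurable
qed

text \<open>For a nonnegative source, a pointwise bound on the Duhamel term is thereby the absolute
  bound that the weak form demands. The almost-everywhere clause of convergence matters: without it
  the space integral could be infinite while its Bochner value is the default 0.\<close>

lemma duhamel_nn_integral:
  fixes f :: "real \<Rightarrow> real ^ 'n \<Rightarrow> real"
  assumes f: "\<And>\<tau> y. f \<tau> y \<ge> 0" and conv: "duhamel_convergent f s x"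
  shows "(\<integral>\<^sup>+\<tau>. \<integral>\<^sup>+y. ennreal (indicator {0<..<s} \<tau> * (heat_kernel (s - \<tau>) (x - y) * \<bar>f \<tau> y\<bar>)) \<partial>lborel \<partial>lborel)
    = ennreal (duhamel f s x)"
proof -
  have int: "set_integrable lborel {0<..<s} (\<lambda>\<tau>. heat_semigroup (s - \<tau>) (f \<tau>) x)"
    and ae: "AE \<tau> in lborel. \<tau> \<in> {0<..<s} \<longrightarrow> heat_convergent (s - \<tau>) (f \<tau>) x"
    using conv by (auto simp: duhamel_convergent_def)
  have pos: "heat_semigroup (s - \<tau>) (f \<tau>) x \<ge> 0" for \<tau>
    by (auto simp: heat_semigroup_def f heat_kernel_nonneg intro!: Bochner_Integration.integral_nonneg)
  have "(\<integral>\<^sup>+\<tau>. \<integral>\<^sup>+y. ennreal (indicator {0<..<s} \<tau> * (heat_kernel (s - \<tau>) (x - y) * \<bar>f \<tau> y\<bar>)) \<partial>lborel \<partial>lborel) =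
      (\<integral>\<^sup>+\<tau>. ennreal (indicator {0<..<s} \<tau> *\<^sub>R heat_semigroup (s - \<tau>) (f \<tau>) x) \<partial>lborel)"
  proof (rule nn_integral_cong_AE)
    show "AE \<tau> in lborel. (\<integral>\<^sup>+y. ennreal (indicator {0<..<s} \<tau> * (heat_kernel (s - \<tau>) (x - y) * \<bar>f \<tau> y\<bar>)) \<partial>lborel) =
        ennreal (indicator {0<..<s} \<tau> *\<^sub>R heat_semigroup (s - \<tau>) (f \<tau>) x)"
      using ae
    proof eventually_elim
      case (elim \<tau>)
      show ?case
      proof (cases "\<tau> \<in> {0<..<s}")
        case True
        with elim have "integrable lborel (\<lambda>y. heat_kernel (s - \<tau>) (x - y) * f \<tau> y)"
          by (auto simp: heat_convergent_def)
        from nn_integral_eq_integral[OF this] True show ?thesis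
          by (simp add: heat_semigroup_def f heat_kernel_nonneg)
      qed simp
    qed
  qed
  also have "\<dots> = ennreal (duhamel f s x)"
    unfolding duhamel_def set_lebesgue_integral_def using int pos
    by (intro nn_integral_eq_integral) (auto simp: set_integrable_def)
  finally show ?thesis .
qed

lemma separated_source_bound:
  fixes w :: "real ^ 'n \<Rightarrow> real"
  assumes z: "set_integrable lborel {0<..<T} z" "\<And>\<tau>. z \<tau> \<ge> 0" and [measurable]: "z \<in> borel_measurable borel"
    and W: "\<And>x. \<bar>w x\<bar> \<le> W" "W \<ge> 0" and s: "s \<le> T"
  shows "(\<integral>\<^sup>+\<tau>. \<integral>\<^sup>+y. ennreal (indicator {0<..<s} \<tau> * (heat_kernel (s - \<tau>) (x - y) * \<bar>z \<tau> * w y\<bar>)) \<partial>lborel \<partial>lborel)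
    \<le> ennreal (W * (LINT \<tau>:{0<..<T}|lborel. z \<tau>))"
proof -
  have "(\<integral>\<^sup>+y. ennreal (indicator {0<..<s} \<tau> * (heat_kernel (s - \<tau>) (x - y) * \<bar>z \<tau> * w y\<bar>)) \<partial>lborel) \<le>
      ennreal (W * (indicator {0<..<T} \<tau> *\<^sub>R z \<tau>))" for \<tau>
  proof (cases "\<tau> \<in> {0<..<s}")
    case True
    have "(\<integral>\<^sup>+y. ennreal (indicator {0<..<s} \<tau> * (heat_kernel (s - \<tau>) (x - y) * \<bar>z \<tau> * w y\<bar>)) \<partial>lborel) \<le>
        (\<integral>\<^sup>+y. ennreal (heat_kernel (s - \<tau>) (x - y)) * ennreal (W * z \<tau>) \<partial>lborel)"
    proof (rule nn_integral_mono)
      fix y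
      have "\<bar>z \<tau> * w y\<bar> \<le> W * z \<tau>"
        using mult_left_mono[OF W(1)[of y] z(2)[of \<tau>]] z(2)[of \<tau>] by (simp add: abs_mult mult.commute)
      then show "ennreal (indicator {0<..<s} \<tau> * (heat_kernel (s - \<tau>) (x - y) * \<bar>z \<tau> * w y\<bar>)) \<le>
          ennreal (heat_kernel (s - \<tau>) (x - y)) * ennreal (W * z \<tau>)"
        using True by (simp add: ennreal_mult'[symmetric] heat_kernel_nonneg ennreal_leI mult_left_mono)
    qed
    also have "\<dots> = ennreal (W * z \<tau>)"
      using True by (simp add: nn_integral_multc heat_kernel_mass)
    finally show ?thesis using True s by simp
  qed simp
  then have "(\<integral>\<^sup>+\<tau>. \<integral>\<^sup>+y. ennreal (indicator {0<..<s} \<tau> * (heat_kernel (s - \<tau>) (x - y) * \<bar>z \<tau> * w y\<bar>)) \<partial>lborel \<partial>lborel)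
      \<le> (\<integral>\<^sup>+\<tau>. ennreal (W * (indicator {0<..<T} \<tau> *\<^sub>R z \<tau>)) \<partial>lborel)"
    by (rule nn_integral_mono)
  also have "\<dots> = ennreal (LINT \<tau>|lborel. W * (indicator {0<..<T} \<tau> *\<^sub>R z \<tau>))"
    using z W by (intro nn_integral_eq_integral) (auto simp: set_integrable_def)
  finally show ?thesis by (simp add: set_lebesgue_integral_def)
qed

text \<open>Continuity is asked at \<open>t\<close> only, since the integrand may be unbounded near
  time 0, as t^\<sigma> is for \<sigma> < 0.\<close>

lemma DERIV_set_integral:
  fixes h :: "real \<Rightarrow> real"
  assumes h: "set_integrable lborel {0<..<T} h" and t: "0 < t" "t < T" and c: "isCont h t"
  shows "((\<lambda>r. LINT s:{0<..<r}|lborel. h s) has_real_derivative h t) (at t)"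
proof -
  have eq: "(LINT s:{0<..<r}|lborel. h s) = integral {0..r} h" if "r < T" for r
  proof -
    have "set_integrable lborel {0<..<r} h"
      by (rule set_integrable_subset[OF h]) (use that in auto)
    then show ?thesis
      by (simp add: set_borel_integral_eq_integral integral_open_interval_real)
  qed
  have "h integrable_on {0..T}"
    using set_borel_integral_eq_integral(1)[OF h] integrable_on_open_interval_real[of h 0 T] by simp
  then have "((\<lambda>r. integral {0..r} h) has_vector_derivative h t) (at t within {0..T} - {})"
    using t c by (intro integral_has_vector_derivative_continuous_at) (auto intro: continuous_at_imp_continuous_within)
  then have "((\<lambda>r. integral {0..r} h) has_real_derivative h t) (at t)"
    using t by (simp add: has_real_derivative_iff_has_vector_derivative at_within_Icc_at)
  then show ?thesis
    by (rule has_field_derivative_transform_within_open[of _ _ _ "{..<T}"]) (use t eq in auto)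
qed


text \<open>The datum and forcing parts of u are bounded, and u is bounded, hence so is the
  remaining Duhamel term; its integrand is nonnegative, so the weak form applies to it too. Adding
  the three weak forms writes the energy as the integral of a function \<open>h\<close> that is
  continuous after time 1.\<close>

lemma mild_solution_energy:
  fixes \<psi> L w :: "real ^ 'n \<Rightarrow> real"
  assumes \<sigma>: "\<sigma> > -1" and m: "m > 0" and p: "p > 0" and w: "w \<in> C0" and u0: "u0 \<in> CB_on UNIV"
    and u: "\<And>T. T > 0 \<Longrightarrow> (\<lambda>(t, x). u t x) \<in> CB_on ({0..T} \<times> UNIV)"
    and mild: "mild_solution \<alpha> p (\<zeta> \<sigma> m) w u0 u"
    and \<psi>: "has_laplacian \<psi> L" and K: "compact K" "0 \<notin> K" "\<And>x. x \<notin> K \<Longrightarrow> \<psi> x = 0" and t: "t > 1"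
  shows "continuous_on UNIV (u t)"
    and "((\<lambda>t. LINT x|lborel. u t x * \<psi> x) has_real_derivative
      (LINT x|lborel. u t x * L x + norm x powr \<alpha> * \<bar>u t x\<bar> powr p * \<psi> x)
      + t powr m * (LINT x|lborel. w x * \<psi> x)) (at t)"
proof -
  \<comment> \<open>Any T > t would do: it makes t an interior point.\<close>
  define T where "T = t + 1"
  have T: "T > 0" "t < T" using t by (auto simp: T_def)
  note cont = has_laplacian_continuous[OF \<psi>]
  note Kc = compact_imp_closed[OF K(1)]
  have L0: "L x = 0" if "x \<notin> K" for x
    by (rule has_laplacian_support[OF \<psi> Kc K(3) that])
  note int = integrable_compact_support[OF _ K(1)]
  have i\<psi>: "integrable lborel \<psi>" and iL: "integrable lborel L"
    using int[OF cont(1) K(3)] int[OF cont(2) L0] by auto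
  obtain W where W: "W \<ge> 0" "\<And>x. \<bar>w x\<bar> \<le> W" using C0_bounded[OF w] by metis
  have wc: "continuous_on UNIV w" using w by (auto simp: C0_def)
  then have [measurable]: "w \<in> borel_measurable borel" by (rule borel_measurable_continuous_onI)
  have [measurable]: "\<psi> \<in> borel_measurable borel" by (rule borel_measurable_continuous_onI[OF cont(1)])
  have u0c: "continuous_on UNIV u0" using u0 by (auto simp: CB_on_def)
  then have u0m: "u0 \<in> borel_measurable borel" by (rule borel_measurable_continuous_onI)
  obtain B0 where B0: "\<And>x. \<bar>u0 x\<bar> \<le> B0" using u0 by (auto simp: CB_on_def bounded_iff)
  have uc: "continuous_on ({0..T} \<times> UNIV) (\<lambda>(t, x). u t x)"
    and ub: "bounded ((\<lambda>(t, x). u t x) ` ({0..T} \<times> UNIV))"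
    using u[OF T(1)] by (auto simp: CB_on_def)
  from ub obtain Bu where "\<forall>v\<in>(\<lambda>(t, x). u t x) ` ({0..T} \<times> UNIV). norm v \<le> Bu"
    unfolding bounded_iff by blast
  then have Bu: "\<bar>u s x\<bar> \<le> Bu" if "s \<in> {0..T}" for s x using that by force
  have us: "continuous_on UNIV (u s)" if "s \<in> {0..T}" for s
    by (rule joint_imp_slice_continuous[OF uc that])
  show "continuous_on UNIV (u t)" using us T t by simp
  define f where "f \<tau> y = norm y powr \<alpha> * \<bar>u \<tau> y\<bar> powr p" for \<tau> and y :: "real ^ 'n"
  define z where "z = \<zeta> \<sigma> m"
  define F where "F \<tau> y = z \<tau> * w y" for \<tau> and y :: "real ^ 'n"
  have z: "set_integrable lborel {0<..<T} z" "\<And>\<tau>. z \<tau> \<ge> 0" and [measurable]: "z \<in> borel_measurable borel"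
    unfolding z_def using T by (auto simp: \<zeta>_nonneg intro!: \<zeta>_integrable[OF \<sigma> m])
  have M: "u s x = heat_semigroup s u0 x + duhamel f s x + duhamel F s x" "duhamel_convergent f s x"
    if "s \<ge> 0" for s x
    using mild that unfolding mild_solution_def f_def F_def z_def by auto

  define BF where "BF = W * (LINT \<tau>:{0<..<T}|lborel. z \<tau>)"
  have F_bound: "(\<integral>\<^sup>+\<tau>. \<integral>\<^sup>+y. ennreal (indicator {0<..<s} \<tau> * (heat_kernel (s - \<tau>) (x - y) * \<bar>F \<tau> y\<bar>)) \<partial>lborel \<partial>lborel)
      \<le> ennreal BF" if "s \<le> T" for s x
    unfolding F_def BF_def by (rule separated_source_bound[OF z _ W(2,1) that]) measurable
  have F_meas: "(\<lambda>p. indicator {0<..<r} (fst p) * F (fst p) (snd p)) \<in> borel_measurable (lborel \<Otimes>\<^sub>M lborel)" for r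
    unfolding F_def by measurable
  have F\<psi>: "integrable (lborel \<Otimes>\<^sub>M lborel) (\<lambda>p. indicator {0<..<r} (fst p) * (F (fst p) (snd p) * \<psi> (snd p)))"
    if r: "r \<le> T" for r
  proof (rule lborel_pair.Fubini_integrable)
    note [continuous_intros] = cont[THEN continuous_on_compose2] continuous_on_compose2[OF wc]
    have iw: "integrable lborel (\<lambda>y. w y * \<psi> y)"
      by (intro int continuous_intros) (auto simp: K(3))
    have zr: "integrable lborel (\<lambda>\<tau>. indicator {0<..<r} \<tau> * z \<tau>)"
    proof -
      have "set_integrable lborel {0<..<r} z"
        by (rule set_integrable_subset[OF z(1)]) (use r in auto)
      then show ?thesis by (simp add: set_integrable_def)
    qed
    show "(\<lambda>p. indicator {0<..<r} (fst p) * (F (fst p) (snd p) * \<psi> (snd p))) \<in> borel_measurable (lborel \<Otimes>\<^sub>M lborel)"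
      unfolding F_def by measurable
    have e: "indicator {0<..<r} \<tau> * (F \<tau> y * \<psi> y) = (indicator {0<..<r} \<tau> * z \<tau>) * (w y * \<psi> y)" for \<tau> y
      by (simp add: F_def)
    show "integrable lborel (\<lambda>\<tau>. LINT y|lborel. norm (indicator {0<..<r} (fst (\<tau>, y)) * (F (fst (\<tau>, y)) (snd (\<tau>, y)) * \<psi> (snd (\<tau>, y)))))"
      unfolding fst_conv snd_conv e norm_mult[of "_ * z _"] using zr by simp
    show "AE \<tau> in lborel. integrable lborel (\<lambda>y. indicator {0<..<r} (fst (\<tau>, y)) * (F (fst (\<tau>, y)) (snd (\<tau>, y)) * \<psi> (snd (\<tau>, y))))"
      unfolding fst_conv snd_conv e using iw by simp
  qed
  note DF = duhamel_weak_form[OF _ F_meas F_bound \<psi> K(1,3) F\<psi>]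
  have S0: "\<bar>heat_semigroup s u0 x\<bar> \<le> max B0 0" if "0 < s" for s x
    by (rule heat_semigroup_weak_form(1)[OF that u0m B0 \<psi> K(1,3) that order_refl])

  \<comment> \<open>Not an estimate of \<open>f\<close>: the bound comes from solving the mild
    formula for the Duhamel term of \<open>f\<close>.\<close>
  define Bf where "Bf = Bu + max B0 0 + max BF 0"
  have f_bound: "(\<integral>\<^sup>+\<tau>. \<integral>\<^sup>+y. ennreal (indicator {0<..<s} \<tau> * (heat_kernel (s - \<tau>) (x - y) * \<bar>f \<tau> y\<bar>)) \<partial>lborel \<partial>lborel)
      \<le> ennreal Bf" if s: "0 < s" "s \<le> T" for s x
  proof -
    have "\<bar>duhamel F s x\<bar> \<le> max BF 0"
      by (rule DF(1)[of s]) (use s in auto)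
    then have "duhamel f s x \<le> Bf"
      using M(1)[of s x] Bu[of s x] S0[of s x] s by (simp add: Bf_def)
    then show ?thesis
      using duhamel_nn_integral[OF _ M(2)[of s x]] s by (simp add: f_def ennreal_leI)
  qed
  have f_meas: "(\<lambda>p. indicator {0<..<r} (fst p) * f (fst p) (snd p)) \<in> borel_measurable (lborel \<Otimes>\<^sub>M lborel)"
    if r: "r \<le> T" for r
  proof -
    have "continuous_on ({0<..<r} \<times> UNIV) (\<lambda>(t, x). u t x)"
      by (rule continuous_on_subset[OF uc]) (use r in auto)
    moreover have "{0<..<r} \<times> (UNIV :: (real ^ 'n) set) \<in> sets borel"
      by (intro borel_open open_Times) auto
    ultimately have "(\<lambda>q. indicator ({0<..<r} \<times> UNIV) q *\<^sub>R (case q of (t, x) \<Rightarrow> u t x)) \<in> borel_measurable borel"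
      by (intro borel_measurable_continuous_on_indicator)
    then have [measurable]: "(\<lambda>q. indicator ({0<..<r} \<times> UNIV) q *\<^sub>R (case q of (t, x) \<Rightarrow> u t x)) \<in> borel_measurable (lborel \<Otimes>\<^sub>M lborel)"
      by (simp add: lborel_prod)
    have "(\<lambda>q. norm (snd q) powr \<alpha> * \<bar>indicator ({0<..<r} \<times> UNIV) q *\<^sub>R (case q of (t, x) \<Rightarrow> u t x)\<bar> powr p)
        \<in> borel_measurable (lborel \<Otimes>\<^sub>M lborel)" by measurable
    also have "(\<lambda>q. norm (snd q) powr \<alpha> * \<bar>indicator ({0<..<r} \<times> UNIV) q *\<^sub>R (case q of (t, x) \<Rightarrow> u t x)\<bar> powr p) =
        (\<lambda>q. indicator {0<..<r} (fst q) * f (fst q) (snd q))"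
      using p by (auto simp: f_def indicator_def fun_eq_iff)
    finally show ?thesis .
  qed
  have f\<psi>: "integrable (lborel \<Otimes>\<^sub>M lborel) (\<lambda>q. indicator {0<..<r} (fst q) * (f (fst q) (snd q) * \<psi> (snd q)))"
    if r: "r \<le> T" for r
  proof -
    \<comment> \<open>The summand with factor 0 gives the shape of
      \<open>continuous_on_energy_density\<close>, with the zero function in place of
      \<open>L\<close>.\<close>
    let ?g = "\<lambda>(t, x). u t x * 0 + norm x powr \<alpha> * \<bar>u t x\<bar> powr p * \<psi> x"
    have "continuous_on ({0..T} \<times> UNIV) ?g"
      by (rule continuous_on_energy_density[OF uc continuous_on_const cont(1) Kc K(2,3) p])
    then have "integrable lborel (\<lambda>q. indicator ({0..T} \<times> K) q *\<^sub>R ?g q)"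
      by (intro borel_integrable_compact compact_Times K(1)) (auto intro: continuous_on_subset)
    then have "integrable lborel (\<lambda>q. indicator ({0<..<r} \<times> UNIV) q *\<^sub>R (indicator ({0..T} \<times> K) q *\<^sub>R ?g q))"
    proof (rule integrable_mult_indicator[rotated])
      have "{0<..<r} \<times> (UNIV :: (real ^ 'n) set) \<in> sets borel"
        by (intro borel_open open_Times) auto
      then show "{0<..<r} \<times> (UNIV :: (real ^ 'n) set) \<in> sets lborel" by simp
    qed
    also have "(\<lambda>q. indicator ({0<..<r} \<times> UNIV) q *\<^sub>R (indicator ({0..T} \<times> K) q *\<^sub>R ?g q)) =
        (\<lambda>q. indicator {0<..<r} (fst q) * (f (fst q) (snd q) * \<psi> (snd q)))"
      using r K(3) by (auto simp: f_def indicator_def fun_eq_iff)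
    finally show ?thesis by (simp add: lborel_prod)
  qed
  note Df = duhamel_weak_form[OF _ f_meas f_bound \<psi> K(1,3) f\<psi>]
  note D0 = heat_semigroup_weak_form[OF _ u0m B0 \<psi> K(1,3)]

  define a1 where "a1 s = (LINT x|lborel. heat_semigroup s u0 x * L x)" for s
  define a2 where "a2 s = (LINT x|lborel. duhamel f s x * L x)" for s
  define a3 where "a3 s = (LINT x|lborel. duhamel F s x * L x)" for s
  define b2 where "b2 s = (LINT x|lborel. f s x * \<psi> x)" for s
  define b3 where "b3 s = (LINT x|lborel. F s x * \<psi> x)" for s
  define h where "h s = a1 s + a2 s + a3 s + b2 s + b3 s" for s
  have si: "set_integrable lborel {0<..<r} a1" "set_integrable lborel {0<..<r} a2" "set_integrable lborel {0<..<r} a3"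
    "set_integrable lborel {0<..<r} b2" "set_integrable lborel {0<..<r} b3" if "0 < r" "r \<le> T" for r
    unfolding a1_def a2_def a3_def b2_def b3_def
    using that by (auto intro!: D0(3) Df(3) DF(3) Df(4) DF(4))
  have energy: "(LINT x|lborel. u r x * \<psi> x) = (LINT y|lborel. u0 y * \<psi> y) + (LINT s:{0<..<r}|lborel. h s)"
    if r: "0 < r" "r \<le> T" for r
  proof -
    have "(LINT x|lborel. u r x * \<psi> x) =
        (LINT x|lborel. heat_semigroup r u0 x * \<psi> x + duhamel f r x * \<psi> x + duhamel F r x * \<psi> x)"
      using r by (simp add: M(1) algebra_simps)
    also have "\<dots> = (LINT x|lborel. heat_semigroup r u0 x * \<psi> x) + (LINT x|lborel. duhamel f r x * \<psi> x)
        + (LINT x|lborel. duhamel F r x * \<psi> x)"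
      using D0(2)[of r r \<psi>] Df(2)[of r r \<psi>] DF(2)[of r r \<psi>] r i\<psi> by simp
    also have "\<dots> = (LINT y|lborel. u0 y * \<psi> y) + ((LINT s:{0<..<r}|lborel. a1 s) + (LINT s:{0<..<r}|lborel. a2 s)
        + (LINT s:{0<..<r}|lborel. a3 s) + (LINT s:{0<..<r}|lborel. b2 s) + (LINT s:{0<..<r}|lborel. b3 s))"
      using D0(4)[of r] Df(5)[of r] DF(5)[of r] r
      by (simp add: a1_def a2_def a3_def b2_def b3_def)
    also have "\<dots> = (LINT y|lborel. u0 y * \<psi> y) + (LINT s:{0<..<r}|lborel. h s)"
      unfolding h_def using si[OF r] by (simp add: set_integral_add)
    finally show ?thesis .
  qed
  define k where "k s = (LINT x|lborel. u s x * L x + norm x powr \<alpha> * \<bar>u s x\<bar> powr p * \<psi> x)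
      + z s * (LINT x|lborel. w x * \<psi> x)" for s
  \<comment> \<open>By the mild formula the three pairings with \<open>L\<close> add up to the
    pairing of u itself, so the decomposition disappears from the derivative.\<close>
  have hk: "h s = k s" if s: "0 < s" "s \<le> T" for s
  proof -
    have usc: "continuous_on UNIV (u s)" using us s by simp
    have iu: "integrable lborel (\<lambda>x. norm x powr \<alpha> * \<bar>u s x\<bar> powr p * \<psi> x)"
      using K(3) p by (intro int continuous_on_weight[OF usc cont(1) Kc K(2)]) auto
    have i: "integrable lborel (\<lambda>x. heat_semigroup s u0 x * L x)" "integrable lborel (\<lambda>x. duhamel f s x * L x)"
      "integrable lborel (\<lambda>x. duhamel F s x * L x)"
      using D0(2)[of s s L] Df(2)[of s s L] DF(2)[of s s L] s iL by auto
    have "a1 s + a2 s + a3 s = (LINT x|lborel. heat_semigroup s u0 x * L x + duhamel f s x * L x + duhamel F s x * L x)"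
      using i by (simp add: a1_def a2_def a3_def)
    also have "\<dots> = (LINT x|lborel. u s x * L x)"
      using s by (simp add: M(1) algebra_simps)
    finally have "a1 s + a2 s + a3 s = (LINT x|lborel. u s x * L x)" .
    moreover have "integrable lborel (\<lambda>x. u s x * L x)"
      using L0 by (intro int continuous_on_mult usc cont(2)) auto
    ultimately show ?thesis
      using iu by (simp add: h_def k_def b2_def b3_def f_def F_def mult.assoc)
  qed
  have "continuous_on {1<..<T} k"
  proof -
    have "continuous_on ({1<..<T} \<times> UNIV) (\<lambda>(t, x). u t x * L x + norm x powr \<alpha> * \<bar>u t x\<bar> powr p * \<psi> x)"
      by (rule continuous_on_energy_density[OF continuous_on_subset[OF uc] cont(2,1) Kc K(2,3) p]) auto
    then have "continuous_on {1<..<T} (\<lambda>t. LINT x|lborel. u t x * L x + norm x powr \<alpha> * \<bar>u t x\<bar> powr p * \<psi> x)"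
      by (rule integral_continuous_on_compact_support[OF _ K(1)]) (simp add: L0 K(3))
    moreover have "continuous_on {1<..<T} z"
    proof (rule continuous_on_eq)
      show "continuous_on {1<..<T} (\<lambda>s. s powr m)" by (intro continuous_intros) auto
    qed (auto simp: z_def \<zeta>_def)
    ultimately show ?thesis unfolding k_def by (intro continuous_intros)
  qed
  then have "continuous_on {1<..<T} h"
    by (rule continuous_on_eq) (use hk in auto)
  then have hc: "isCont h t"
    using t T by (simp add: continuous_on_eq_continuous_at)
  have hT: "set_integrable lborel {0<..<T} h"
    unfolding h_def using si[OF T(1) order_refl] by (intro set_integral_add) auto
  have "((\<lambda>r. (LINT y|lborel. u0 y * \<psi> y) + (LINT s:{0<..<r}|lborel. h s)) has_real_derivative h t) (at t)"
    using DERIV_add[OF DERIV_const DERIV_set_integral[OF hT _ T(2) hc]] t by simp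
  then have "((\<lambda>r. LINT x|lborel. u r x * \<psi> x) has_real_derivative h t) (at t)"
    by (rule has_field_derivative_transform_within_open[of _ _ _ "{0<..<T}"]) (use t T energy in auto)
  then show "((\<lambda>t. LINT x|lborel. u t x * \<psi> x) has_real_derivative
      (LINT x|lborel. u t x * L x + norm x powr \<alpha> * \<bar>u t x\<bar> powr p * \<psi> x)
      + t powr m * (LINT x|lborel. w x * \<psi> x)) (at t)"
    using hk[of t] t T by (simp add: k_def z_def \<zeta>_def)
qed

theorem theorem1p4:
  fixes \<alpha> \<sigma> m p :: real and w :: "real ^ 'n \<Rightarrow> real"
  assumes "\<sigma> > -1" and "m > 0" and "p > 1"
    and "w \<in> C0" and "integrable lborel w"
    and "(LINT x|lborel. w x) > 0"
  shows "\<not> (\<exists>u0 u. global_solution \<alpha> p (\<zeta> \<sigma> m) w u0 u)"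
proof
  assume "\<exists>u0 u. global_solution \<alpha> p (\<zeta> \<sigma> m) w u0 u"
  then obtain u0 u where sol: "global_solution \<alpha> p (\<zeta> \<sigma> m) w u0 u" by blast
  have p: "p > 0" using assms(3) by simp
  obtain \<psi> L :: "real ^ 'n \<Rightarrow> real" and K C where \<psi>: "has_laplacian \<psi> L"
    and K: "compact K" "0 \<notin> K" "\<And>x. x \<notin> K \<Longrightarrow> \<psi> x = 0" and nonneg: "\<And>x. \<psi> x \<ge> 0"
    and LC: "\<And>x. \<bar>L x\<bar> \<le> C * \<psi> x powr (1 / p)" and pos: "(LINT x|lborel. w x * \<psi> x) > 0"
    using exists_test_function[OF assms(3,5,6)] by blast
  \<comment> \<open>After time 1 both notions of solution satisfy the same energy identity, so the
    sign of \<alpha> no longer matters.\<close>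
  have "continuous_on UNIV (u t) \<and> ((\<lambda>t. LINT x|lborel. u t x * \<psi> x) has_real_derivative
      (LINT x|lborel. u t x * L x + norm x powr \<alpha> * \<bar>u t x\<bar> powr p * \<psi> x)
      + t powr m * (LINT x|lborel. w x * \<psi> x)) (at t)" if t: "t > 1" for t
  proof (cases "\<alpha> \<le> 0")
    case True
    then have "u0 \<in> CB_on UNIV" "\<And>T. T > 0 \<Longrightarrow> (\<lambda>(t, x). u t x) \<in> CB_on ({0..T} \<times> UNIV)"
      "mild_solution \<alpha> p (\<zeta> \<sigma> m) w u0 u"
      using sol by (auto simp: global_solution_def)
    from mild_solution_energy[OF assms(1,2) p assms(4) this \<psi> K t] show ?thesis by blast
  next
    case False
    then have cl: "classical_solution \<alpha> p (\<zeta> \<sigma> m) w u0 u"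
      using sol by (simp add: global_solution_def)
    have "continuous_on UNIV w" using assms(4) by (simp add: C0_def)
    from classical_solution_energy[OF cl p this \<psi> K, of t] t show ?thesis by (simp add: \<zeta>_def)
  qed
  then show False
    using no_global_energy[OF assms(3,2) \<psi> K nonneg LC pos, of u \<alpha>] by blast
qed

end
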